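(* Let $(G,w,a)$ be an infinite, locally finite, connected, oriented, weighted graph. Let $\sigma\colon E_0\to U(1)$ satisfy $\sigma(\widehat e)=\overline{\sigma(e)}$ for all $e\in E_0$, let $q\colon V\to\mathbb{R}$, and let $H=\Delta_\sigma+q$. Assume that $G$ is a graph of bounded degree and that $(G,d_{w,a})$ is a complete metric space. Additionally, assume that there exists a constant $C\in\mathbb{R}$ such that $$(Hu,u)\ge -C\|u\|^2\qquad\text{for all }u\in C_c(V).$$ Then the operator $H|_{C_c(V)}$ is essentially self-adjoint in $\ell^2_w(V)$.
   Context: $G=(V,E)$ is a graph with vertex set $V$ and set of unoriented edges $E$, without loops and without multiple edges between vertices. $m(x)$ denotes the degree of the vertex $x$ (number of edges meeting at $x$); locally finite means $m(x)<\infty$ for every $x$; bounded degree means there is a constant $N>0$ with $m(x)\le N$ for all $x\in V$. $x\sim y$ means there is an edge connecting $x$ and $y$. Connected means any two vertices are joined by a finite path $x_1,\dots,x_n$ with $x_j\sim x_{j+1}$. Oriented edges: $E_0=\{[x,y],[y,x]: x,y\in V,\ x\sim y\}$; for $e=[x,y]$, $o(e)=x$ is the starting vertex, $t(e)=y$ the terminal vertex, and $\widehat e=[y,x]$ the reverse edge. An orientation is fixed by a choice of subset $E_s\subset E_0$ with $E_0=E_s\cup\widehat{E_s}$ (disjoint union), where $\widehat{E_s}=\{\widehat e: e\in E_s\}$ ("oriented graph" means that such a choice has been made). For $x\in V$, $\mathcal{O}_x=\{e\in E_0: o(e)=x\}$. Weights: $w\colon V\to\mathbb{R}^+=(0,\infty)$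 and $a\colon E_0\to\mathbb{R}^+$ with $a(e)=a(\widehat e)$ for all $e\in E_0$. Weighted distance: for $x,y\in V$, $d_{w,a}(x,y):=\inf_{\gamma\in P_{x,y}}L_{w,a}(\gamma)$, where $P_{x,y}$ is the set of all paths $\gamma\colon x=x_1,x_2,\dots,x_n=y$ with $x_j\sim x_{j+1}$ for $1\le j\le n-1$, and $$L_{w,a}(\gamma)=\sum_{j=1}^{n-1}\sqrt{\frac{\min\{w(x_j),w(x_{j+1})\}}{a([x_j,x_{j+1}])}}.$$ $(G,d_{w,a})$ is called complete if every Cauchy sequence of vertices (with respect to $d_{w,a}$) has a limit in $V$. $U(1)=\{z\in\mathbb{C}:|z|=1\}$. $C(V)$ is the space of complex-valued functions on $V$ and $C_c(V)$ its subspace of finitely supported functions. $\ell^2_w(V)$ is the Hilbert space of $f\in C(V)$ with $\|f\|<\infty$, with inner product $(f,g)=\sum_{x\in V}w(x)f(x)\overline{g(x)}$ and corresponding norm $\|\cdot\|$. The magnetic Laplacian $\Delta_\sigma\colon C(V)\to C(V)$ is $$(\Delta_\sigma u)(x)=\frac{1}{w(x)}\sum_{e\in\mathcal{O}_x}a(e)\bigl(u(x)-\sigma(\widehat e)u(t(e))\bigr),$$ and $Hu=\Delta_\sigma u+qu$. *)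

theory Defs
  imports "HOL-Analysis.Analysis"
begin

(* The vertex set V is the whole type 'v, so C(V) is the function type 'v => complex.
   E is the set of unoriented edges; an oriented edge [x,y] is the pair (x,y), so that
   o(e) = fst e, t(e) = snd e, and the reverse edge is prod.swap e. *)

definition simple_graph :: "'v set set \<Rightarrow> bool" where
  "simple_graph E \<longleftrightarrow> (\<forall>e\<in>E. \<exists>x y. x \<noteq> y \<and> e = {x, y})"

definition locally_finite_graph :: "'v set set \<Rightarrow> bool" where
  "locally_finite_graph E \<longleftrightarrow> (\<forall>x. finite {e\<in>E. x \<in> e})"

definition degree :: "'v set set \<Rightarrow> 'v \<Rightarrow> nat" where
  "degree E x = card {e\<in>E. x \<in> e}"

(* Local finiteness is included because card is 0 on infinite sets. *)
definition bounded_degree :: "'v set set \<Rightarrow> bool" where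
  "bounded_degree E \<longleftrightarrow>
     locally_finite_graph E \<and> (\<exists>N::real. N > 0 \<and> (\<forall>x. real (degree E x) \<le> N))"

definition oriented_edges :: "'v set set \<Rightarrow> ('v \<times> 'v) set" where
  "oriented_edges E = {(x, y). {x, y} \<in> E}"

definition out_edges :: "'v set set \<Rightarrow> 'v \<Rightarrow> ('v \<times> 'v) set" where
  "out_edges E x = {e \<in> oriented_edges E. fst e = x}"

definition orientation :: "'v set set \<Rightarrow> ('v \<times> 'v) set \<Rightarrow> bool" where
  "orientation E Es \<longleftrightarrow>
     oriented_edges E = Es \<union> prod.swap ` Es \<and> Es \<inter> prod.swap ` Es = {}"

(* Paths are vertex lists; the one-vertex path is a path from x to x, of length 0. *)
definition graph_paths :: "'v set set \<Rightarrow> 'v \<Rightarrow> 'v \<Rightarrow> 'v list set" where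
  "graph_paths E x y =
     {xs. xs \<noteq> [] \<and> hd xs = x \<and> last xs = y \<and>
          (\<forall>j. Suc j < length xs \<longrightarrow> {xs ! j, xs ! Suc j} \<in> E)}"

definition connected_graph :: "'v set set \<Rightarrow> bool" where
  "connected_graph E \<longleftrightarrow> (\<forall>x y. graph_paths E x y \<noteq> {})"

definition vertex_weight :: "('v \<Rightarrow> real) \<Rightarrow> bool" where
  "vertex_weight w \<longleftrightarrow> (\<forall>x. w x > 0)"

definition edge_weight :: "'v set set \<Rightarrow> ('v \<times> 'v \<Rightarrow> real) \<Rightarrow> bool" where
  "edge_weight E a \<longleftrightarrow> (\<forall>e\<in>oriented_edges E. a e > 0 \<and> a e = a (prod.swap e))"

definition U1_phase :: "'v set set \<Rightarrow> ('v \<times> 'v \<Rightarrow> complex) \<Rightarrow> bool" where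
  "U1_phase E \<sigma> \<longleftrightarrow>
     (\<forall>e\<in>oriented_edges E. cmod (\<sigma> e) = 1 \<and> \<sigma> (prod.swap e) = cnj (\<sigma> e))"

definition path_weight :: "('v \<Rightarrow> real) \<Rightarrow> ('v \<times> 'v \<Rightarrow> real) \<Rightarrow> 'v list \<Rightarrow> real" where
  "path_weight w a xs =
     (\<Sum>j<length xs - 1. sqrt (min (w (xs ! j)) (w (xs ! Suc j)) / a (xs ! j, xs ! Suc j)))"

definition wdist ::
  "'v set set \<Rightarrow> ('v \<Rightarrow> real) \<Rightarrow> ('v \<times> 'v \<Rightarrow> real) \<Rightarrow> 'v \<Rightarrow> 'v \<Rightarrow> real" where
  "wdist E w a x y = (INF xs\<in>graph_paths E x y. path_weight w a xs)"

definition complete_metric :: "('v \<Rightarrow> 'v \<Rightarrow> real) \<Rightarrow> bool" where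
  "complete_metric d \<longleftrightarrow> Metric_space UNIV d \<and> Metric_space.mcomplete UNIV d"

definition magnetic_laplacian ::
  "'v set set \<Rightarrow> ('v \<Rightarrow> real) \<Rightarrow> ('v \<times> 'v \<Rightarrow> real) \<Rightarrow> ('v \<times> 'v \<Rightarrow> complex)
     \<Rightarrow> ('v \<Rightarrow> complex) \<Rightarrow> 'v \<Rightarrow> complex" where
  "magnetic_laplacian E w a \<sigma> u x =
     1 / of_real (w x) *
     (\<Sum>e\<in>out_edges E x. of_real (a e) * (u x - \<sigma> (prod.swap e) * u (snd e)))"

definition magnetic_schroedinger ::
  "'v set set \<Rightarrow> ('v \<Rightarrow> real) \<Rightarrow> ('v \<times> 'v \<Rightarrow> real) \<Rightarrow> ('v \<times> 'v \<Rightarrow> complex) \<Rightarrow> ('v \<Rightarrow> real)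
     \<Rightarrow> ('v \<Rightarrow> complex) \<Rightarrow> 'v \<Rightarrow> complex" where
  "magnetic_schroedinger E w a \<sigma> q u x = magnetic_laplacian E w a \<sigma> u x + of_real (q x) * u x"

definition finitely_supported :: "('v \<Rightarrow> complex) set" where
  "finitely_supported = {u. finite {x. u x \<noteq> 0}}"

definition ell2 :: "('v \<Rightarrow> real) \<Rightarrow> ('v \<Rightarrow> complex) set" where
  "ell2 w = {f. (\<lambda>x. w x * (cmod (f x))\<^sup>2) summable_on UNIV}"

definition ell2_inner :: "('v \<Rightarrow> real) \<Rightarrow> ('v \<Rightarrow> complex) \<Rightarrow> ('v \<Rightarrow> complex) \<Rightarrow> complex" where
  "ell2_inner w f g = (\<Sum>\<^sub>\<infinity>x. of_real (w x) * f x * cnj (g x))"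

definition ell2_norm :: "('v \<Rightarrow> real) \<Rightarrow> ('v \<Rightarrow> complex) \<Rightarrow> real" where
  "ell2_norm w f = sqrt (\<Sum>\<^sub>\<infinity>x. w x * (cmod (f x))\<^sup>2)"

(* Unbounded operators in ell2 w are represented by their graphs. *)

type_synonym 'v op_graph = "(('v \<Rightarrow> complex) \<times> ('v \<Rightarrow> complex)) set"

definition restrict_op ::
  "(('v \<Rightarrow> complex) \<Rightarrow> 'v \<Rightarrow> complex) \<Rightarrow> ('v \<Rightarrow> complex) set \<Rightarrow> 'v op_graph" where
  "restrict_op T D = {(u, T u) | u. u \<in> D}"

definition linear_op :: "('v \<Rightarrow> real) \<Rightarrow> 'v op_graph \<Rightarrow> bool" where
  "linear_op w T \<longleftrightarrow>
     T \<subseteq> ell2 w \<times> ell2 w \<and> single_valued T \<and> ((\<lambda>x. 0), (\<lambda>x. 0)) \<in> T \<and>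
     (\<forall>(u, f)\<in>T. \<forall>(v, g)\<in>T. ((\<lambda>x. u x + v x), (\<lambda>x. f x + g x)) \<in> T) \<and>
     (\<forall>c. \<forall>(u, f)\<in>T. ((\<lambda>x. c * u x), (\<lambda>x. c * f x)) \<in> T)"

definition densely_defined :: "('v \<Rightarrow> real) \<Rightarrow> 'v op_graph \<Rightarrow> bool" where
  "densely_defined w T \<longleftrightarrow>
     (\<forall>u\<in>ell2 w. \<forall>\<epsilon>>0. \<exists>v\<in>Domain T. ell2_norm w (\<lambda>x. u x - v x) < \<epsilon>)"

definition adjoint_op :: "('v \<Rightarrow> real) \<Rightarrow> 'v op_graph \<Rightarrow> 'v op_graph" where
  "adjoint_op w T =
     {(v, g) \<in> ell2 w \<times> ell2 w. \<forall>(u, f)\<in>T. ell2_inner w f v = ell2_inner w u g}"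

definition closure_op :: "('v \<Rightarrow> real) \<Rightarrow> 'v op_graph \<Rightarrow> 'v op_graph" where
  "closure_op w T =
     {(u, f) \<in> ell2 w \<times> ell2 w. \<exists>us fs. (\<forall>n. (us n, fs n) \<in> T) \<and>
        (\<lambda>n::nat. ell2_norm w (\<lambda>x. us n x - u x)) \<longlonglongrightarrow> 0 \<and>
        (\<lambda>n. ell2_norm w (\<lambda>x. fs n x - f x)) \<longlonglongrightarrow> 0}"

definition symmetric_op :: "('v \<Rightarrow> real) \<Rightarrow> 'v op_graph \<Rightarrow> bool" where
  "symmetric_op w T \<longleftrightarrow>
     linear_op w T \<and> densely_defined w T \<and>
     (\<forall>(u, f)\<in>T. \<forall>(v, g)\<in>T. ell2_inner w f v = ell2_inner w u g)"

definition self_adjoint_op :: "('v \<Rightarrow> real) \<Rightarrow> 'v op_graph \<Rightarrow> bool" where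
  "self_adjoint_op w T \<longleftrightarrow> linear_op w T \<and> densely_defined w T \<and> adjoint_op w T = T"

definition essentially_self_adjoint :: "('v \<Rightarrow> real) \<Rightarrow> 'v op_graph \<Rightarrow> bool" where
  "essentially_self_adjoint w T \<longleftrightarrow> symmetric_op w T \<and> self_adjoint_op w (closure_op w T)"

end

theory Submission
  imports Defs
begin

text \<open>After adding a constant to \<open>q\<close> one has \<open>\<parallel>u\<parallel>\<^sup>2 \<le> (H u, u)\<close> for finitely supported \<open>u\<close>, and it
  suffices that \<open>H v = 0\<close> with \<open>v \<in> \<ell>\<^sup>2\<close> forces \<open>v = 0\<close>. Completeness and local finiteness
  make all balls finite, so the cutoffs \<open>\<phi> = max 0 (1 - d(x,\<cdot>) / n)\<close> have finite support. For a
  solution \<open>v\<close> the form \<open>(H(\<phi> v), \<phi> v)\<close> involves only the terms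
  \<open>a(e) (\<phi>(o e) - \<phi>(t e))\<^sup>2\<close>, each at most \<open>w / n\<^sup>2\<close> by the choice of the metric; with degrees
  bounded by \<open>N\<close> this gives \<open>w x |v x|\<^sup>2 \<le> \<parallel>\<phi> v\<parallel>\<^sup>2 \<le> N \<parallel>v\<parallel>\<^sup>2 / (2 n\<^sup>2)\<close>, which tends to \<open>0\<close>.\<close>

section \<open>The weighted sequence space\<close>

locale vertex_weighted =
  fixes w :: "'v \<Rightarrow> real"
  assumes vertex_weight: "vertex_weight w"
begin

lemma w_pos: "w x > 0"
  using vertex_weight by (simp add: vertex_weight_def)

lemma w_nonneg [simp]: "w x \<ge> 0"
  using w_pos[of x] by simp

text \<open>Writing finite partial sums through \<open>L2_set\<close> makes the finite Minkowski and
  Cauchy-Schwarz inequalities available; results for the whole space follow from bounds uniform in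
  the finite set.\<close>

abbreviation partial_norm :: "('v \<Rightarrow> complex) \<Rightarrow> 'v set \<Rightarrow> real" where
  "partial_norm f F \<equiv> L2_set (\<lambda>x. sqrt (w x) * cmod (f x)) F"

lemma partial_norm_power2: "(partial_norm f F)\<^sup>2 = (\<Sum>x\<in>F. w x * (cmod (f x))\<^sup>2)"
  by (simp add: L2_set_def power_mult_distrib sum_nonneg)

lemma ell2_norm_nonneg [simp]: "ell2_norm w f \<ge> 0"
  by (simp add: ell2_norm_def infsum_nonneg)

lemma ell2_norm_power2: "(ell2_norm w f)\<^sup>2 = (\<Sum>\<^sub>\<infinity>x. w x * (cmod (f x))\<^sup>2)"
  by (simp add: ell2_norm_def infsum_nonneg)

lemma sum_le_ell2_norm_power2:
  assumes "f \<in> ell2 w" "finite F"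
  shows "(\<Sum>x\<in>F. w x * (cmod (f x))\<^sup>2) \<le> (ell2_norm w f)\<^sup>2"
  unfolding ell2_norm_power2 using assms
  by (intro finite_sum_le_infsum) (auto simp: ell2_def)

lemma partial_norm_le_ell2_norm:
  assumes "f \<in> ell2 w" "finite F"
  shows "partial_norm f F \<le> ell2_norm w f"
  using sum_le_ell2_norm_power2[OF assms]
  by (simp add: partial_norm_power2 power2_le_imp_le)

text \<open>Membership and the norm bound come together because \<open>infsum\<close> is 0 on
  families that are not summable, so a bound on \<open>ell2_norm\<close> alone would not show that
  \<open>f\<close> lies in the space.\<close>

lemma
  assumes "\<And>F. finite F \<Longrightarrow> partial_norm f F \<le> B"
  shows ell2I: "f \<in> ell2 w" and ell2_norm_leI: "ell2_norm w f \<le> B"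
proof -
  have B: "B \<ge> 0"
    using assms[of "{}"] by simp
  have le: "(\<Sum>x\<in>F. w x * (cmod (f x))\<^sup>2) \<le> B\<^sup>2" if "finite F" for F
    using power_mono[OF assms[OF that] L2_set_nonneg, of 2] by (simp add: partial_norm_power2)
  show f: "f \<in> ell2 w"
    unfolding ell2_def mem_Collect_eq
    by (rule nonneg_bdd_above_summable_on) (auto intro!: bdd_aboveI2[where M = "B\<^sup>2"] le)
  have "(ell2_norm w f)\<^sup>2 \<le> B\<^sup>2"
    unfolding ell2_norm_power2 using f le by (intro infsum_le_finite_sums) (auto simp: ell2_def)
  then show "ell2_norm w f \<le> B"
    using B power2_le_imp_le by blast
qed

lemma pointwise_le_ell2_norm:
  assumes "f \<in> ell2 w"
  shows "sqrt (w x) * cmod (f x) \<le> ell2_norm w f"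
  using partial_norm_le_ell2_norm[OF assms, of "{x}"] by simp

lemma
  assumes f: "f \<in> ell2 w" and g: "g \<in> ell2 w"
  shows ell2_add: "(\<lambda>x. f x + g x) \<in> ell2 w"
    and ell2_norm_triangle: "ell2_norm w (\<lambda>x. f x + g x) \<le> ell2_norm w f + ell2_norm w g"
proof -
  have "partial_norm (\<lambda>x. f x + g x) F \<le> ell2_norm w f + ell2_norm w g" if "finite F" for F
  proof -
    have "partial_norm (\<lambda>x. f x + g x) F
        \<le> L2_set (\<lambda>x. sqrt (w x) * cmod (f x) + sqrt (w x) * cmod (g x)) F"
      by (intro L2_set_mono)
        (auto simp: norm_triangle_ineq mult_left_mono simp flip: distrib_left)
    also have "\<dots> \<le> partial_norm f F + partial_norm g F"
      by (rule L2_set_triangle_ineq)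
    also have "\<dots> \<le> ell2_norm w f + ell2_norm w g"
      using partial_norm_le_ell2_norm[OF f that] partial_norm_le_ell2_norm[OF g that] by simp
    finally show ?thesis .
  qed
  then show "(\<lambda>x. f x + g x) \<in> ell2 w"
    and "ell2_norm w (\<lambda>x. f x + g x) \<le> ell2_norm w f + ell2_norm w g"
    by (blast intro: ell2I ell2_norm_leI)+
qed

lemma ell2_scale:
  assumes "f \<in> ell2 w"
  shows "(\<lambda>x. c * f x) \<in> ell2 w"
  using summable_on_cmult_right[of "\<lambda>x. w x * (cmod (f x))\<^sup>2" UNIV "(cmod c)\<^sup>2"] assms
  by (simp add: ell2_def norm_mult power_mult_distrib ac_simps)

lemma ell2_diff:
  assumes "f \<in> ell2 w" "g \<in> ell2 w"
  shows "(\<lambda>x. f x - g x) \<in> ell2 w"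
  using ell2_add[OF assms(1) ell2_scale[OF assms(2), of "-1"]] by simp

lemma ell2_norm_minus_commute: "ell2_norm w (\<lambda>x. f x - g x) = ell2_norm w (\<lambda>x. g x - f x)"
  by (simp add: ell2_norm_def norm_minus_commute)

lemma ell2_norm_scale: "ell2_norm w (\<lambda>x. c * f x) = cmod c * ell2_norm w f"
proof -
  have "(\<Sum>\<^sub>\<infinity>x. w x * (cmod (c * f x))\<^sup>2) = (\<Sum>\<^sub>\<infinity>x. (cmod c)\<^sup>2 * (w x * (cmod (f x))\<^sup>2))"
    by (simp add: norm_mult power_mult_distrib ac_simps)
  also have "\<dots> = (cmod c)\<^sup>2 * (\<Sum>\<^sub>\<infinity>x. w x * (cmod (f x))\<^sup>2)"
    by (rule infsum_cmult_right')
  finally show ?thesis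
    by (simp add: ell2_norm_def real_sqrt_mult)
qed

section \<open>Inner product and norm identities\<close>

lemma
  assumes f: "f \<in> ell2 w" and g: "g \<in> ell2 w"
  shows inner_abs_summable: "(\<lambda>x. cmod (of_real (w x) * f x * cnj (g x))) summable_on UNIV"
    and ell2_Cauchy_Schwarz: "cmod (ell2_inner w f g) \<le> ell2_norm w f * ell2_norm w g"
proof -
  let ?h = "\<lambda>x. of_real (w x) * f x * cnj (g x)"
  have le: "(\<Sum>x\<in>F. norm (?h x)) \<le> ell2_norm w f * ell2_norm w g" if "finite F" for F
  proof -
    \<comment> \<open>The weight is split as \<open>sqrt (w x) * sqrt (w x)\<close>, one factor for
      each function, so that \<open>L2_set_mult_ineq\<close> applies.\<close>
    have "(\<Sum>x\<in>F. norm (?h x))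
        = (\<Sum>x\<in>F. \<bar>sqrt (w x) * cmod (f x)\<bar> * \<bar>sqrt (w x) * cmod (g x)\<bar>)"
    proof (intro sum.cong refl)
      fix x
      have "\<bar>sqrt (w x) * cmod (f x)\<bar> * \<bar>sqrt (w x) * cmod (g x)\<bar>
          = (sqrt (w x) * sqrt (w x)) * (cmod (f x) * cmod (g x))"
        by (simp add: abs_mult ac_simps del: real_sqrt_mult_self)
      then show "norm (?h x) = \<bar>sqrt (w x) * cmod (f x)\<bar> * \<bar>sqrt (w x) * cmod (g x)\<bar>"
        by (simp add: norm_mult)
    qed
    also have "\<dots> \<le> partial_norm f F * partial_norm g F"
      by (rule L2_set_mult_ineq)
    also have "\<dots> \<le> ell2_norm w f * ell2_norm w g"
      using partial_norm_le_ell2_norm f g that by (intro mult_mono) auto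
    finally show ?thesis .
  qed
  show abs: "(\<lambda>x. cmod (?h x)) summable_on UNIV"
    unfolding abs_summable_iff_bdd_above using le by (auto intro!: bdd_aboveI2)
  have "cmod (ell2_inner w f g) \<le> (\<Sum>\<^sub>\<infinity>x. norm (?h x))"
    unfolding ell2_inner_def using abs by (rule norm_infsum_bound)
  also have "\<dots> \<le> ell2_norm w f * ell2_norm w g"
    using abs le by (intro infsum_le_finite_sums) auto
  finally show "cmod (ell2_inner w f g) \<le> ell2_norm w f * ell2_norm w g" .
qed

lemma inner_summable:
  assumes "f \<in> ell2 w" "g \<in> ell2 w"
  shows "(\<lambda>x. of_real (w x) * f x * cnj (g x)) summable_on UNIV"
  using inner_abs_summable[OF assms] by (rule abs_summable_summable)

lemma ell2_inner_add_left:
  assumes "f \<in> ell2 w" "g \<in> ell2 w" "h \<in> ell2 w"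
  shows "ell2_inner w (\<lambda>x. f x + g x) h = ell2_inner w f h + ell2_inner w g h"
  unfolding ell2_inner_def using assms
  by (subst infsum_add[symmetric]) (simp_all only: inner_summable distrib_left distrib_right)

text \<open>No summability is assumed: \<open>infsum_cmult_right'\<close> holds also when both sides
  take the default value 0.\<close>

lemma ell2_inner_scale_left: "ell2_inner w (\<lambda>x. c * f x) h = c * ell2_inner w f h"
  unfolding ell2_inner_def by (subst infsum_cmult_right'[symmetric]) (simp add: ac_simps)

lemma ell2_inner_commute: "ell2_inner w f g = cnj (ell2_inner w g f)"
  unfolding ell2_inner_def by (subst infsum_cnj[symmetric]) (simp add: ac_simps)

lemma ell2_inner_diff_left:
  assumes "f \<in> ell2 w" "g \<in> ell2 w" "h \<in> ell2 w"
  shows "ell2_inner w (\<lambda>x. f x - g x) h = ell2_inner w f h - ell2_inner w g h"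
  using ell2_inner_add_left[OF assms(1) ell2_scale[OF assms(2), of "-1"] assms(3)]
    ell2_inner_scale_left[of "-1" g h] by simp

lemma ell2_inner_self:
  assumes "f \<in> ell2 w"
  shows "ell2_inner w f f = of_real ((ell2_norm w f)\<^sup>2)"
proof -
  have "(\<lambda>x. of_real (w x) * f x * cnj (f x)) = (\<lambda>x. of_real (w x * (cmod (f x))\<^sup>2))"
    by (simp add: complex_norm_square[symmetric] mult.assoc)
  moreover have "((\<lambda>x. w x * (cmod (f x))\<^sup>2) has_sum (ell2_norm w f)\<^sup>2) UNIV"
    unfolding ell2_norm_power2 using assms by (simp add: ell2_def)
  ultimately show ?thesis
    unfolding ell2_inner_def by (simp only: infsumI[OF has_sum_of_real])
qed

lemma ell2_inner_diff_right:
  assumes "f \<in> ell2 w" "g \<in> ell2 w" "h \<in> ell2 w"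
  shows "ell2_inner w h (\<lambda>x. f x - g x) = ell2_inner w h f - ell2_inner w h g"
  by (subst (1 2 3) ell2_inner_commute) (simp add: ell2_inner_diff_left assms)

lemma ell2_norm_diff_power2:
  assumes "f \<in> ell2 w" "g \<in> ell2 w"
  shows "(ell2_norm w (\<lambda>x. f x - g x))\<^sup>2
    = (ell2_norm w f)\<^sup>2 - 2 * Re (ell2_inner w f g) + (ell2_norm w g)\<^sup>2"
proof -
  have "complex_of_real ((ell2_norm w (\<lambda>x. f x - g x))\<^sup>2)
    = ell2_inner w f f - ell2_inner w f g - cnj (ell2_inner w f g) + ell2_inner w g g"
    unfolding ell2_inner_self[OF ell2_diff[OF assms], symmetric]
    by (simp add: ell2_inner_diff_left ell2_inner_diff_right assms ell2_diff
        flip: ell2_inner_commute)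
  from this[THEN arg_cong[where f = Re]] show ?thesis
    by (simp add: ell2_inner_self assms del: of_real_power)
qed

text \<open>The expansion of the squared norm of a difference is used for \<open>g\<close> and for
  \<open>-1 * g\<close>; the cross terms cancel in the sum.\<close>

lemma ell2_parallelogram:
  assumes f: "f \<in> ell2 w" and g: "g \<in> ell2 w"
  shows "(ell2_norm w (\<lambda>x. f x - g x))\<^sup>2 + (ell2_norm w (\<lambda>x. f x + g x))\<^sup>2
    = 2 * (ell2_norm w f)\<^sup>2 + 2 * (ell2_norm w g)\<^sup>2"
  using ell2_norm_diff_power2[OF f g] ell2_norm_diff_power2[OF f ell2_scale[OF g, of "-1"]]
    ell2_norm_scale[of "-1" g] ell2_inner_scale_left[of "-1" g f]
    ell2_inner_commute[of f g] ell2_inner_commute[of f "\<lambda>x. -1 * g x"]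
  by simp

section \<open>Completeness, limits and projection\<close>

lemma ell2_complete:
  assumes us: "\<And>n. us n \<in> ell2 w"
    and Cauchy: "\<And>\<epsilon>. \<epsilon> > 0 \<Longrightarrow> \<exists>N. \<forall>m\<ge>N. \<forall>n\<ge>N. ell2_norm w (\<lambda>x. us m x - us n x) < \<epsilon>"
  obtains u where "u \<in> ell2 w" "(\<lambda>n. ell2_norm w (\<lambda>x. us n x - u x)) \<longlonglongrightarrow> 0"
proof -
  have "convergent (\<lambda>n. us n x)" for x
  proof (rule Cauchy_convergent, rule CauchyI)
    fix e :: real
    assume e: "e > 0"
    then obtain N where N: "\<And>m n. m \<ge> N \<Longrightarrow> n \<ge> N \<Longrightarrow>
        ell2_norm w (\<lambda>x. us m x - us n x) < sqrt (w x) * e"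
      using Cauchy[of "sqrt (w x) * e"] w_pos[of x] by auto
    have "cmod (us m x - us n x) < e" if "m \<ge> N" "n \<ge> N" for m n
    proof -
      have "sqrt (w x) * cmod (us m x - us n x) < sqrt (w x) * e"
        using pointwise_le_ell2_norm[OF ell2_diff[OF us us]] N[OF that] by (rule le_less_trans)
      then show ?thesis
        using w_pos[of x] by simp
    qed
    then show "\<exists>M. \<forall>m\<ge>M. \<forall>n\<ge>M. cmod (us m x - us n x) < e"
      by blast
  qed
  then obtain u where u: "\<And>x. (\<lambda>n. us n x) \<longlonglongrightarrow> u x"
    unfolding convergent_def by metis
  \<comment> \<open>The limit in \<open>m\<close> is taken for each finite \<open>F\<close>
    separately, with \<open>N\<close> independent of \<open>F\<close>. This avoids exchanging a
    limit with an infinite sum.\<close>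
  have close: "\<exists>N. \<forall>n\<ge>N. \<forall>F. finite F \<longrightarrow> partial_norm (\<lambda>x. us n x - u x) F \<le> \<epsilon>"
    if "\<epsilon> > 0" for \<epsilon>
  proof -
    obtain N where N: "\<And>m n. m \<ge> N \<Longrightarrow> n \<ge> N \<Longrightarrow> ell2_norm w (\<lambda>x. us m x - us n x) < \<epsilon>"
      using Cauchy[OF \<open>\<epsilon> > 0\<close>] by auto
    have "partial_norm (\<lambda>x. us n x - u x) F \<le> \<epsilon>" if "n \<ge> N" "finite F" for n F
    proof (rule tendsto_upperbound)
      show "(\<lambda>m. partial_norm (\<lambda>x. us n x - us m x) F) \<longlonglongrightarrow> partial_norm (\<lambda>x. us n x - u x) F"
        unfolding L2_set_def by (intro tendsto_intros u)
      show "\<forall>\<^sub>F m in sequentially. partial_norm (\<lambda>x. us n x - us m x) F \<le> \<epsilon>"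
        using partial_norm_le_ell2_norm[OF ell2_diff[OF us us] \<open>finite F\<close>] N[OF \<open>n \<ge> N\<close>]
        by (intro eventually_sequentiallyI[of N]) (meson less_imp_le order_trans)
    qed simp
    then show ?thesis
      by blast
  qed
  obtain N where "\<And>F. finite F \<Longrightarrow> partial_norm (\<lambda>x. us N x - u x) F \<le> 1"
    using close[of 1] by auto
  then have "(\<lambda>x. us N x - u x) \<in> ell2 w"
    by (rule ell2I)
  \<comment> \<open>The limit is recovered as \<open>us N x - (us N x - u x)\<close>, a difference
    of two members.\<close>
  from ell2_diff[OF us this, of N] have "u \<in> ell2 w"
    by simp
  moreover have "(\<lambda>n. ell2_norm w (\<lambda>x. us n x - u x)) \<longlonglongrightarrow> 0"
  proof (rule LIMSEQ_I)
    fix r :: real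
    assume "r > 0"
    then obtain N where "\<And>n F. n \<ge> N \<Longrightarrow> finite F \<Longrightarrow> partial_norm (\<lambda>x. us n x - u x) F \<le> r / 2"
      using close[of "r / 2"] by auto
    then have "\<And>n. n \<ge> N \<Longrightarrow> ell2_norm w (\<lambda>x. us n x - u x) \<le> r / 2"
      by (intro ell2_norm_leI)
    then show "\<exists>no. \<forall>n\<ge>no. norm (ell2_norm w (\<lambda>x. us n x - u x) - 0) < r"
      using \<open>r > 0\<close> by (intro exI[of _ N]) fastforce
  qed
  ultimately show ?thesis
    by (rule that)
qed

lemma ell2_norm_tendsto:
  assumes us: "\<And>n. us n \<in> ell2 w" and u: "u \<in> ell2 w"
    and lim: "(\<lambda>n. ell2_norm w (\<lambda>x. us n x - u x)) \<longlonglongrightarrow> 0"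
  shows "(\<lambda>n. ell2_norm w (us n)) \<longlonglongrightarrow> ell2_norm w u"
proof (rule LIM_zero_cancel, rule Lim_null_comparison[OF _ lim])
  show "\<forall>\<^sub>F n in sequentially. norm (ell2_norm w (us n) - ell2_norm w u)
      \<le> ell2_norm w (\<lambda>x. us n x - u x)"
  proof (rule always_eventually, rule allI)
    fix n
    show "norm (ell2_norm w (us n) - ell2_norm w u) \<le> ell2_norm w (\<lambda>x. us n x - u x)"
      using ell2_norm_triangle[OF ell2_diff[OF us u] u, of n]
        ell2_norm_triangle[OF ell2_diff[OF u us] us, of n n]
        ell2_norm_minus_commute[of "us n" u] by simp
  qed
qed

lemma ell2_inner_tendsto_left:
  assumes us: "\<And>n. us n \<in> ell2 w" and u: "u \<in> ell2 w" and v: "v \<in> ell2 w"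
    and lim: "(\<lambda>n. ell2_norm w (\<lambda>x. us n x - u x)) \<longlonglongrightarrow> 0"
  shows "(\<lambda>n. ell2_inner w (us n) v) \<longlonglongrightarrow> ell2_inner w u v"
proof (rule LIM_zero_cancel, rule Lim_null_comparison)
  show "(\<lambda>n. ell2_norm w (\<lambda>x. us n x - u x) * ell2_norm w v) \<longlonglongrightarrow> 0"
    using tendsto_mult_left_zero[OF lim] .
  show "\<forall>\<^sub>F n in sequentially. norm (ell2_inner w (us n) v - ell2_inner w u v)
      \<le> ell2_norm w (\<lambda>x. us n x - u x) * ell2_norm w v"
    using ell2_Cauchy_Schwarz[OF ell2_diff[OF us u] v]
    by (intro always_eventually) (simp add: ell2_inner_diff_left us u v)
qed

text \<open>Positivity of \<open>w x\<close> makes evaluation at \<open>x\<close> continuous in the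
  norm, with constant \<open>1 / sqrt (w x)\<close>.\<close>

lemma ell2_pointwise_tendsto:
  assumes us: "\<And>n. us n \<in> ell2 w" and u: "u \<in> ell2 w"
    and lim: "(\<lambda>n. ell2_norm w (\<lambda>x. us n x - u x)) \<longlonglongrightarrow> 0"
  shows "(\<lambda>n. us n x) \<longlonglongrightarrow> u x"
proof (rule LIM_zero_cancel, rule Lim_null_comparison)
  show "(\<lambda>n. ell2_norm w (\<lambda>x. us n x - u x) / sqrt (w x)) \<longlonglongrightarrow> 0"
    using tendsto_divide_zero[OF lim] .
  show "\<forall>\<^sub>F n in sequentially. norm (us n x - u x) \<le> ell2_norm w (\<lambda>x. us n x - u x) / sqrt (w x)"
    using pointwise_le_ell2_norm[OF ell2_diff[OF us u], where x = x] w_pos[of x]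
    by (intro always_eventually) (simp add: field_simps)
qed

text \<open>The projection theorem for the closure of \<open>M\<close>: a minimizing sequence for the distance from
  \<open>f\<close> to \<open>M\<close> is Cauchy by the parallelogram law, and the residual of its limit is orthogonal
  to \<open>M\<close>.\<close>

lemma ell2_dense_if_orthogonal_trivial:
  assumes M: "M \<subseteq> ell2 w" "M \<noteq> {}"
    and M_add: "\<And>g h. g \<in> M \<Longrightarrow> h \<in> M \<Longrightarrow> (\<lambda>x. g x + h x) \<in> M"
    and M_scale: "\<And>c g. g \<in> M \<Longrightarrow> (\<lambda>x. c * g x) \<in> M"
    and orth: "\<And>g. g \<in> ell2 w \<Longrightarrow> (\<And>m. m \<in> M \<Longrightarrow> ell2_inner w m g = 0) \<Longrightarrow> g = (\<lambda>x. 0)"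
    and f: "f \<in> ell2 w"
  obtains ms where "\<And>n::nat. ms n \<in> M" "(\<lambda>n. ell2_norm w (\<lambda>x. ms n x - f x)) \<longlonglongrightarrow> 0"
proof -
  define dist where "dist m = ell2_norm w (\<lambda>x. m x - f x)" for m
  define \<delta> where "\<delta> = (INF m\<in>M. dist m)"
  have bdd: "bdd_below (dist ` M)"
    by (rule bdd_belowI2[where m = 0]) (simp add: dist_def)
  have \<delta>_le: "\<delta> \<le> dist m" if "m \<in> M" for m
    unfolding \<delta>_def using bdd that by (rule cINF_lower)
  have \<delta>_nonneg: "\<delta> \<ge> 0"
    unfolding \<delta>_def using M(2) by (rule cINF_greatest) (simp add: dist_def)
  \<comment> \<open>The infimum need not be attained in \<open>M\<close>, so its square is
    approached with error below \<open>1 / Suc n\<close>.\<close>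
  have "\<exists>m\<in>M. (dist m)\<^sup>2 < \<delta>\<^sup>2 + 1 / Suc n" for n
  proof -
    have "\<delta> < sqrt (\<delta>\<^sup>2 + 1 / Suc n)"
      using \<delta>_nonneg by (intro real_less_rsqrt) simp
    then obtain m where m: "m \<in> M" "dist m < sqrt (\<delta>\<^sup>2 + 1 / Suc n)"
      unfolding \<delta>_def using M(2) bdd by (subst (asm) cINF_less_iff) auto
    have "(dist m)\<^sup>2 < (sqrt (\<delta>\<^sup>2 + 1 / Suc n))\<^sup>2"
      using m(2) by (intro power_strict_mono) (auto simp: dist_def)
    also have "\<dots> = \<delta>\<^sup>2 + 1 / Suc n"
      by simp
    finally show ?thesis
      using m(1) by blast
  qed
  then obtain ms where ms: "\<And>n. ms n \<in> M" and ms_dist: "\<And>n. (dist (ms n))\<^sup>2 < \<delta>\<^sup>2 + 1 / Suc n"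
    by metis
  have ms_ell2: "ms n \<in> ell2 w" for n
    using ms M by blast
  have gap: "(ell2_norm w (\<lambda>x. ms m x - ms n x))\<^sup>2 \<le> 2 / Suc m + 2 / Suc n" for m n
  proof -
    let ?mid = "\<lambda>x. (1/2) * (ms m x + ms n x)"
    \<comment> \<open>The midpoint lies in \<open>M\<close>, hence is no closer to \<open>f\<close>
      than \<delta>; in the parallelogram identity only the two approximation errors remain.\<close>
    have "\<delta>\<^sup>2 \<le> (dist ?mid)\<^sup>2"
      using \<delta>_le[OF M_scale[OF M_add[OF ms ms]]] \<delta>_nonneg by (intro power_mono)
    moreover have "(\<lambda>x. (ms m x - f x) + (ms n x - f x)) = (\<lambda>x. 2 * (?mid x - f x))"
      by (simp add: algebra_simps)
    then have "ell2_norm w (\<lambda>x. (ms m x - f x) + (ms n x - f x)) = 2 * dist ?mid"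
      unfolding dist_def using ell2_norm_scale[of 2 "\<lambda>x. ?mid x - f x"] by simp
    ultimately show ?thesis
      using ell2_parallelogram[OF ell2_diff[OF ms_ell2 f] ell2_diff[OF ms_ell2 f], of m n]
        ms_dist[of m] ms_dist[of n]
      unfolding dist_def[symmetric] by (simp add: power_mult_distrib)
  qed
  have "\<exists>N. \<forall>m\<ge>N. \<forall>n\<ge>N. ell2_norm w (\<lambda>x. ms m x - ms n x) < \<epsilon>" if \<epsilon>: "\<epsilon> > 0" for \<epsilon>
  proof -
    obtain N where N: "1 / real (Suc N) < \<epsilon>\<^sup>2 / 4"
      using reals_Archimedean[of "\<epsilon>\<^sup>2 / 4"] \<epsilon> by (auto simp: inverse_eq_divide)
    have "ell2_norm w (\<lambda>x. ms m x - ms n x) < \<epsilon>" if "m \<ge> N" "n \<ge> N" for m n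
    proof (rule power2_less_imp_less)
      have "1 / real (Suc m) \<le> 1 / real (Suc N)" "1 / real (Suc n) \<le> 1 / real (Suc N)"
        using that by (auto intro!: divide_left_mono)
      then show "(ell2_norm w (\<lambda>x. ms m x - ms n x))\<^sup>2 < \<epsilon>\<^sup>2"
        using gap[of m n] N by simp
    qed (use \<epsilon> in simp)
    then show ?thesis
      by blast
  qed
  then obtain h where h: "h \<in> ell2 w" and lim_h: "(\<lambda>n. ell2_norm w (\<lambda>x. ms n x - h x)) \<longlonglongrightarrow> 0"
    using ell2_complete[of ms, OF ms_ell2] by blast
  define g where "g = (\<lambda>x. h x - f x)"
  have g: "g \<in> ell2 w"
    unfolding g_def using h f by (rule ell2_diff)
  \<comment> \<open>The free \<open>k\<close> serves twice: as 0 for the norm of \<open>g\<close>,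
    and as an element of \<open>M\<close> for the minimality of \<open>g\<close>.\<close>
  have shifted: "(\<lambda>n. ell2_norm w (\<lambda>x. (ms n x - k x - f x) - (g x - k x))) \<longlonglongrightarrow> 0" for k
    using lim_h by (simp add: g_def algebra_simps)
  have "(\<lambda>n. ell2_norm w (\<lambda>x. ms n x - f x)) \<longlonglongrightarrow> ell2_norm w g"
    using ell2_norm_tendsto[of "\<lambda>n x. ms n x - f x" g] shifted[of "\<lambda>x. 0"] g
    by (simp add: ell2_diff ms_ell2 f)
  then have "(\<lambda>n. (dist (ms n))\<^sup>2) \<longlonglongrightarrow> (ell2_norm w g)\<^sup>2"
    unfolding dist_def by (intro tendsto_intros)
  moreover have "(\<lambda>n. \<delta>\<^sup>2 + 1 / real (Suc n)) \<longlonglongrightarrow> \<delta>\<^sup>2 + 0"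
    using LIMSEQ_inverse_real_of_nat by (intro tendsto_intros) (simp add: inverse_eq_divide)
  ultimately have g_norm: "(ell2_norm w g)\<^sup>2 \<le> \<delta>\<^sup>2"
    using ms_dist by (intro LIMSEQ_le) (auto intro: less_imp_le)
  have g_min: "\<delta> \<le> ell2_norm w (\<lambda>x. g x - m x)" if m: "m \<in> M" for m
  proof (rule LIMSEQ_le_const)
    have mw: "m \<in> ell2 w"
      using m M by blast
    then show "(\<lambda>n. ell2_norm w (\<lambda>x. ms n x - m x - f x)) \<longlonglongrightarrow> ell2_norm w (\<lambda>x. g x - m x)"
      by (intro ell2_norm_tendsto shifted ell2_diff ms_ell2 f g)
    have "\<delta> \<le> ell2_norm w (\<lambda>x. ms n x - m x - f x)" for n
      using \<delta>_le[OF M_add[OF ms M_scale[OF m, of "-1"]]] by (simp add: dist_def)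
    then show "\<exists>N. \<forall>n\<ge>N. \<delta> \<le> ell2_norm w (\<lambda>x. ms n x - m x - f x)"
      by blast
  qed
  have "ell2_inner w m g = 0" if m: "m \<in> M" for m
  proof (rule ccontr)
    assume nz: "ell2_inner w m g \<noteq> 0"
    have mw: "m \<in> ell2 w"
      using m M by blast
    define z where "z = ell2_inner w m g"
    \<comment> \<open>Moving \<open>g\<close> by \<open>c * m\<close> with
      \<open>c = t * cnj z\<close> changes the squared norm by
      \<open>-2 t |z|^2 + t^2 |z|^2 ||m||^2\<close>. This is negative once
      \<open>t ||m||^2 < 2\<close>, against minimality; the added 1 keeps the denominator
      positive.\<close>
    define t where "t = 1 / (1 + (ell2_norm w m)\<^sup>2)"
    have t: "t > 0" "t * (ell2_norm w m)\<^sup>2 < 1"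
      by (simp_all add: t_def add_pos_nonneg divide_less_eq)
    define c where "c = of_real t * cnj z"
    have "\<delta>\<^sup>2 \<le> (ell2_norm w (\<lambda>x. g x - c * m x))\<^sup>2"
      using g_min[OF M_scale[OF m]] \<delta>_nonneg by (intro power_mono)
    also have "\<dots> = (ell2_norm w g)\<^sup>2 - 2 * Re (ell2_inner w g (\<lambda>x. c * m x))
        + (cmod c)\<^sup>2 * (ell2_norm w m)\<^sup>2"
      by (simp add: ell2_norm_diff_power2[OF g ell2_scale[OF mw]] ell2_norm_scale power_mult_distrib)
    also have "Re (ell2_inner w g (\<lambda>x. c * m x)) = t * (cmod z)\<^sup>2"
      by (subst ell2_inner_commute)
        (simp add: ell2_inner_scale_left c_def cmod_power2 flip: z_def, simp add: power2_eq_square algebra_simps)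
    also have "(cmod c)\<^sup>2 = t * t * (cmod z)\<^sup>2"
      using t by (simp add: c_def norm_mult power_mult_distrib power2_eq_square)
    finally have "2 * (t * (cmod z)\<^sup>2) \<le> (t * (cmod z)\<^sup>2) * (t * (ell2_norm w m)\<^sup>2)"
      using g_norm by (simp add: algebra_simps)
    moreover have pos: "t * (cmod z)\<^sup>2 > 0"
      using t nz by (simp add: z_def)
    then have "(t * (cmod z)\<^sup>2) * (t * (ell2_norm w m)\<^sup>2) < (t * (cmod z)\<^sup>2) * 1"
      using t by (intro mult_strict_left_mono)
    ultimately show False
      using pos by linarith
  qed
  then have "g = (\<lambda>x. 0)"
    using orth[OF g] by blast
  then have "h = f"
    by (auto simp: g_def fun_eq_iff)
  then show ?thesis
    using that[of ms] ms lim_h by blast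
qed

section \<open>Finitely supported functions\<close>

lemma finitely_supported_subset_ell2: "finitely_supported \<subseteq> ell2 w"
proof
  fix u :: "'v \<Rightarrow> complex"
  assume "u \<in> finitely_supported"
  then have "(\<lambda>x. w x * (cmod (u x))\<^sup>2) summable_on {x. u x \<noteq> 0}"
    by (simp add: finitely_supported_def)
  then show "u \<in> ell2 w"
    unfolding ell2_def mem_Collect_eq by (rule summable_on_cong_neutral[THEN iffD1, rotated -1]) auto
qed

lemma ell2_inner_finite_support:
  assumes "finite S" "\<And>x. x \<notin> S \<Longrightarrow> f x * cnj (g x) = 0"
  shows "ell2_inner w f g = (\<Sum>x\<in>S. of_real (w x) * f x * cnj (g x))"
  unfolding ell2_inner_def infsum_finite[OF assms(1), symmetric]
  by (rule infsum_cong_neutral) (use assms(2) in auto)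

lemma finitely_supported_dense:
  assumes u: "u \<in> ell2 w" and "\<epsilon> > 0"
  obtains v where "v \<in> finitely_supported" "ell2_norm w (\<lambda>x. u x - v x) < \<epsilon>"
proof -
  let ?h = "\<lambda>x. w x * (cmod (u x))\<^sup>2"
  have sum: "?h summable_on UNIV"
    using u by (simp add: ell2_def)
  obtain F where F: "finite F" "dist (sum ?h F) (infsum ?h UNIV) \<le> (\<epsilon> / 2)\<^sup>2"
    using infsum_finite_approximation[OF sum, of "(\<epsilon> / 2)\<^sup>2"] \<open>\<epsilon> > 0\<close> by auto
  \<comment> \<open>Truncation to \<open>F\<close> leaves an error supported off \<open>F\<close>,
    so each finite partial sum of it is at most the total minus the sum over
    \<open>F\<close>.\<close>
  define v where "v x = (if x \<in> F then u x else 0)" for x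
  have "ell2_norm w (\<lambda>x. u x - v x) \<le> \<epsilon> / 2"
  proof (rule ell2_norm_leI)
    fix A :: "'v set"
    assume A: "finite A"
    have "(partial_norm (\<lambda>x. u x - v x) A)\<^sup>2 = sum ?h (A - F)"
      unfolding partial_norm_power2 using A by (intro sum.mono_neutral_cong_right) (auto simp: v_def)
    also have "\<dots> = sum ?h (A \<union> F) - sum ?h F"
      using A F sum_diff[of "A \<union> F" F ?h] by (simp add: Un_Diff)
    also have "\<dots> \<le> infsum ?h UNIV - sum ?h F"
      using finite_sum_le_infsum[OF sum, of "A \<union> F"] A F by simp
    also have "\<dots> \<le> (\<epsilon> / 2)\<^sup>2"
      using F(2) by (simp add: dist_real_def abs_le_iff)
    finally show "partial_norm (\<lambda>x. u x - v x) A \<le> \<epsilon> / 2"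
      using \<open>\<epsilon> > 0\<close> by (metis power2_le_imp_le less_imp_le half_gt_zero)
  qed
  moreover have "v \<in> finitely_supported"
    using F(1) by (auto simp: finitely_supported_def v_def intro: finite_subset)
  ultimately show ?thesis
    using that[of v] \<open>\<epsilon> > 0\<close> by fastforce
qed

end

lemma finitely_supported_add:
  assumes "u \<in> finitely_supported" "v \<in> finitely_supported"
  shows "(\<lambda>x. u x + v x) \<in> finitely_supported"
proof -
  have "{x. u x + v x \<noteq> 0} \<subseteq> {x. u x \<noteq> 0} \<union> {x. v x \<noteq> 0}"
    by auto
  then show ?thesis
    using assms finite_subset by (fastforce simp: finitely_supported_def)
qed

lemma finitely_supported_scale:
  assumes "u \<in> finitely_supported"
  shows "(\<lambda>x. c * u x) \<in> finitely_supported"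
  using assms by (auto simp: finitely_supported_def elim: rev_finite_subset)

lemma closure_opE:
  assumes "(u, f) \<in> closure_op w T"
  obtains us fs where "u \<in> ell2 w" "f \<in> ell2 w" "\<And>n. (us n, fs n) \<in> T"
    "(\<lambda>n::nat. ell2_norm w (\<lambda>x. us n x - u x)) \<longlonglongrightarrow> 0"
    "(\<lambda>n. ell2_norm w (\<lambda>x. fs n x - f x)) \<longlonglongrightarrow> 0"
  using assms unfolding closure_op_def by blast

lemma closure_opI:
  assumes "u \<in> ell2 w" "f \<in> ell2 w" "\<And>n. (us n, fs n) \<in> T"
    and "(\<lambda>n::nat. ell2_norm w (\<lambda>x. us n x - u x)) \<longlonglongrightarrow> 0"
    and "(\<lambda>n. ell2_norm w (\<lambda>x. fs n x - f x)) \<longlonglongrightarrow> 0"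
  shows "(u, f) \<in> closure_op w T"
  using assms unfolding closure_op_def by blast

section \<open>Magnetic Schroedinger operators\<close>

locale magnetic_graph = vertex_weighted w for w :: "'v \<Rightarrow> real" +
  fixes E :: "'v set set" and a :: "'v \<times> 'v \<Rightarrow> real" and \<sigma> :: "'v \<times> 'v \<Rightarrow> complex"
  assumes simple: "simple_graph E"
    and locally_finite: "locally_finite_graph E"
    and connected: "connected_graph E"
    and edge_weight: "edge_weight E a"
    and phase: "U1_phase E \<sigma>"
begin

abbreviation H :: "('v \<Rightarrow> real) \<Rightarrow> ('v \<Rightarrow> complex) \<Rightarrow> 'v \<Rightarrow> complex" where
  "H \<equiv> magnetic_schroedinger E w a \<sigma>"

definition nbrs :: "'v \<Rightarrow> 'v set" where
  "nbrs x = {y. {x, y} \<in> E}"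

lemma nbrs_sym: "y \<in> nbrs x \<longleftrightarrow> x \<in> nbrs y"
  by (simp add: nbrs_def insert_commute)

lemma not_in_nbrs_self: "x \<notin> nbrs x"
  using simple by (fastforce simp: nbrs_def simple_graph_def doubleton_eq_iff)

text \<open>This carries local finiteness and the degree, both stated for unoriented edges, over to
  neighbour sets.\<close>

lemma bij_betw_nbrs: "bij_betw (\<lambda>y. {x, y}) (nbrs x) {e \<in> E. x \<in> e}"
proof (rule bij_betw_imageI)
  show "inj_on (\<lambda>y. {x, y}) (nbrs x)"
    by (auto simp: inj_on_def doubleton_eq_iff)
  show "(\<lambda>y. {x, y}) ` nbrs x = {e \<in> E. x \<in> e}"
  proof safe
    fix e
    assume e: "e \<in> E" "x \<in> e"
    then obtain y where "e = {x, y}"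
      using simple by (fastforce simp: simple_graph_def)
    then show "e \<in> (\<lambda>y. {x, y}) ` nbrs x"
      using e(1) by (auto simp: nbrs_def)
  qed (auto simp: nbrs_def)
qed

lemma finite_nbrs [simp]: "finite (nbrs x)"
  using bij_betw_finite[OF bij_betw_nbrs] locally_finite by (simp add: locally_finite_graph_def)

lemma card_nbrs: "card (nbrs x) = degree E x"
  unfolding degree_def by (rule bij_betw_same_card[OF bij_betw_nbrs])

lemma out_edges_eq: "out_edges E x = Pair x ` nbrs x"
  by (auto simp: out_edges_def oriented_edges_def nbrs_def)

lemma
  assumes "y \<in> nbrs x"
  shows a_pos: "a (x, y) > 0" and a_sym: "a (y, x) = a (x, y)"
    and norm_phase: "cmod (\<sigma> (x, y)) = 1" and phase_swap: "\<sigma> (y, x) = cnj (\<sigma> (x, y))"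
proof -
  have "(x, y) \<in> oriented_edges E"
    using assms by (simp add: oriented_edges_def nbrs_def)
  then show "a (x, y) > 0" "a (y, x) = a (x, y)" "cmod (\<sigma> (x, y)) = 1" "\<sigma> (y, x) = cnj (\<sigma> (x, y))"
    using edge_weight phase unfolding edge_weight_def U1_phase_def by fastforce+
qed

text \<open>Multiplication by the weight clears the factor \<open>1 / w x\<close>; this is the form
  in which \<open>H\<close> enters inner products.\<close>

lemma weighted_H:
  "of_real (w x) * H q u x
    = (\<Sum>y\<in>nbrs x. of_real (a (x, y)) * (u x - \<sigma> (y, x) * u y)) + of_real (w x) * of_real (q x) * u x"
  using w_pos[of x]
  by (simp add: magnetic_schroedinger_def magnetic_laplacian_def out_edges_eq
      sum.reindex inj_on_def algebra_simps)

lemma H_add: "H q (\<lambda>x. u x + v x) x = H q u x + H q v x"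
  by (simp add: magnetic_schroedinger_def magnetic_laplacian_def algebra_simps
      sum.distrib sum_subtractf)

lemma H_scale: "H q (\<lambda>x. c * u x) x = c * H q u x"
  by (simp add: magnetic_schroedinger_def magnetic_laplacian_def algebra_simps
      sum_distrib_left sum_subtractf)

lemma H_diff: "H q (\<lambda>x. u x - v x) x = H q u x - H q v x"
  using H_add[of q u "\<lambda>x. - 1 * v x"] H_scale[of q "-1" v] by simp

lemma H_shift: "H (\<lambda>x. q x + c) u x = H q u x + of_real c * u x"
  by (simp add: magnetic_schroedinger_def algebra_simps)

lemma H_tendsto:
  assumes "\<And>x. (\<lambda>n. us n x) \<longlonglongrightarrow> u x"
  shows "(\<lambda>n. H q (us n) x) \<longlonglongrightarrow> H q u x"
  unfolding magnetic_schroedinger_def magnetic_laplacian_def by (intro tendsto_intros assms)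

section \<open>Supports and Green's formula\<close>

definition closed_nbhd :: "'v set \<Rightarrow> 'v set" where
  "closed_nbhd S = S \<union> (\<Union>x\<in>S. nbrs x)"

lemma finite_closed_nbhd [simp]: "finite S \<Longrightarrow> finite (closed_nbhd S)"
  by (simp add: closed_nbhd_def)

text \<open>Edges touching a support have both ends in the enlarged set, so one finite set can index
  both variables of an edge sum.\<close>

lemma closed_nbhd_edge:
  assumes "y \<in> nbrs x" "x \<in> S \<or> y \<in> S"
  shows "x \<in> closed_nbhd S" "y \<in> closed_nbhd S"
  using assms nbrs_sym by (auto simp: closed_nbhd_def)

lemma H_support:
  assumes "x \<notin> closed_nbhd {x. u x \<noteq> 0}"
  shows "H q u x = 0"
proof -
  have "u x = 0" "\<And>y. y \<in> nbrs x \<Longrightarrow> u y = 0"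
    using assms closed_nbhd_edge(1)[of _ x "{x. u x \<noteq> 0}"] by (auto simp: closed_nbhd_def)
  then show ?thesis
    by (simp add: magnetic_schroedinger_def magnetic_laplacian_def out_edges_eq sum.neutral)
qed

lemma H_finitely_supported:
  assumes "u \<in> finitely_supported"
  shows "H q u \<in> finitely_supported"
proof -
  have "{x. H q u x \<noteq> 0} \<subseteq> closed_nbhd {x. u x \<noteq> 0}"
    using H_support by blast
  then show ?thesis
    using assms unfolding finitely_supported_def by (auto intro: finite_subset)
qed

text \<open>Both sides become sums over \<open>S\<close> times \<open>S\<close> restricted to
  adjacent pairs. Adjacency is symmetric, and the support condition removes the neighbours outside
  \<open>S\<close>.\<close>

lemma sum_nbrs_swap:
  fixes F :: "'v \<Rightarrow> 'v \<Rightarrow> 'b::comm_monoid_add"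
  assumes S: "finite S"
    and supp: "\<And>x y. y \<in> nbrs x \<Longrightarrow> F x y \<noteq> 0 \<Longrightarrow> x \<in> S \<and> y \<in> S"
  shows "(\<Sum>x\<in>S. \<Sum>y\<in>nbrs x. F x y) = (\<Sum>x\<in>S. \<Sum>y\<in>nbrs x. F y x)"
proof -
  have 1: "(\<Sum>y\<in>nbrs x. F x y) = (\<Sum>y\<in>S. if y \<in> nbrs x then F x y else 0)"
    and 2: "(\<Sum>y\<in>nbrs x. F y x) = (\<Sum>y\<in>S. if y \<in> nbrs x then F y x else 0)" for x
    using S supp supp[where y = x] nbrs_sym
    by (auto simp: sum.inter_restrict[symmetric] intro!: sum.mono_neutral_cong_right)
  have "(\<Sum>x\<in>S. \<Sum>y\<in>nbrs x. F x y) = (\<Sum>y\<in>S. \<Sum>x\<in>S. if y \<in> nbrs x then F x y else 0)"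
    unfolding 1 by (rule sum.swap)
  also have "\<dots> = (\<Sum>x\<in>S. \<Sum>y\<in>nbrs x. F y x)"
    unfolding 2 by (intro sum.cong refl) (simp add: nbrs_sym)
  finally show ?thesis .
qed

text \<open>Finite support of \<open>u\<close> makes both sides finite sums, so \<open>v\<close> may
  be any function. The edge terms match because reversing an edge preserves \<open>a\<close> and
  conjugates \<sigma>.\<close>

lemma Green:
  assumes u: "u \<in> finitely_supported"
  shows "ell2_inner w (H q u) v = ell2_inner w u (H q v)"
proof -
  define S where "S = closed_nbhd {x. u x \<noteq> 0}"
  have S: "finite S"
    using u by (simp add: S_def finitely_supported_def)
  have u0: "u x = 0" if "x \<notin> S" for x
    using that by (auto simp: S_def closed_nbhd_def)
  let ?F = "\<lambda>x y. of_real (a (x, y)) * \<sigma> (y, x) * u y * cnj (v x)"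
  \<comment> \<open>\<open>?D\<close> holds the terms local to a vertex, which both sides share; the
    coupling terms \<open>?F\<close> differ only by exchanging the ends of the edge.\<close>
  let ?D = "\<lambda>x. (\<Sum>y\<in>nbrs x. of_real (a (x, y)) * u x * cnj (v x))
    + of_real (w x) * of_real (q x) * u x * cnj (v x)"
  have left: "of_real (w x) * H q u x * cnj (v x) = ?D x - (\<Sum>y\<in>nbrs x. ?F x y)" for x
    unfolding weighted_H by (simp add: algebra_simps sum_distrib_left sum_subtractf)
  have right: "of_real (w x) * u x * cnj (H q v x) = ?D x - (\<Sum>y\<in>nbrs x. ?F y x)" for x
  proof -
    have "of_real (w x) * u x * cnj (H q v x) = u x * cnj (of_real (w x) * H q v x)"
      by simp
    also have "\<dots> = ?D x - (\<Sum>y\<in>nbrs x. of_real (a (x, y)) * cnj (\<sigma> (y, x)) * u x * cnj (v y))"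
      unfolding weighted_H by (simp add: algebra_simps sum_distrib_left sum_subtractf)
    also have "(\<Sum>y\<in>nbrs x. of_real (a (x, y)) * cnj (\<sigma> (y, x)) * u x * cnj (v y))
        = (\<Sum>y\<in>nbrs x. ?F y x)"
    proof (intro sum.cong refl)
      fix y
      assume y: "y \<in> nbrs x"
      show "of_real (a (x, y)) * cnj (\<sigma> (y, x)) * u x * cnj (v y) = ?F y x"
        by (simp add: a_sym[OF y] phase_swap[OF y])
    qed
    finally show ?thesis .
  qed
  have swap: "(\<Sum>x\<in>S. \<Sum>y\<in>nbrs x. ?F x y) = (\<Sum>x\<in>S. \<Sum>y\<in>nbrs x. ?F y x)"
    using S by (rule sum_nbrs_swap) (use closed_nbhd_edge S_def in auto)
  have "ell2_inner w (H q u) v = (\<Sum>x\<in>S. of_real (w x) * H q u x * cnj (v x))"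
    using S by (rule ell2_inner_finite_support) (use H_support S_def in auto)
  also have "\<dots> = (\<Sum>x\<in>S. of_real (w x) * u x * cnj (H q v x))"
    unfolding left right sum_subtractf swap ..
  also have "\<dots> = ell2_inner w u (H q v)"
    using S by (rule ell2_inner_finite_support[symmetric]) (use u0 in auto)
  finally show ?thesis .
qed

text \<open>Since \<open>H v = 0\<close>, the form of \<open>H\<close> at \<open>\<phi> v\<close> only contains the differences
  \<open>(\<phi> x - \<phi> y)\<^sup>2\<close> along the edges.\<close>

lemma cutoff_estimate:
  fixes \<phi> :: "'v \<Rightarrow> real" and v :: "'v \<Rightarrow> complex"
  assumes fin: "finite {x. \<phi> x \<noteq> 0}"
    and L: "\<And>x y. y \<in> nbrs x \<Longrightarrow> a (x, y) * (\<phi> x - \<phi> y)\<^sup>2 \<le> L * w x" "L \<ge> 0"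
    and N: "\<And>x. real (degree E x) \<le> N"
    and v: "v \<in> ell2 w" "\<And>x. H q v x = 0"
  shows "Re (ell2_inner w (H q (\<lambda>x. \<phi> x * v x)) (\<lambda>x. \<phi> x * v x)) \<le> L * N / 2 * (ell2_norm w v)\<^sup>2"
proof -
  define S where "S = closed_nbhd {x. \<phi> x \<noteq> 0}"
  have S: "finite S"
    using fin by (simp add: S_def)
  have edge_S: "x \<in> S \<and> y \<in> S" if "y \<in> nbrs x" "\<phi> x \<noteq> 0 \<or> \<phi> y \<noteq> 0" for x y
    using closed_nbhd_edge[of y x "{x. \<phi> x \<noteq> 0}"] that by (auto simp: S_def)
  \<comment> \<open>\<open>K\<close> is the real coupling of an edge, the same in both directions;
    \<open>F\<close> is the edge term of the form, and \<open>G\<close> is the error that will be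
    bounded.\<close>
  define K where "K x y = a (x, y) * Re (\<sigma> (y, x) * v y * cnj (v x))" for x y
  define F where "F x y = K x y * \<phi> x * (\<phi> x - \<phi> y)" for x y
  define G where "G x y = a (x, y) * (\<phi> x - \<phi> y)\<^sup>2 * (cmod (v x))\<^sup>2" for x y
  let ?u = "\<lambda>x. \<phi> x * v x"
  have form: "of_real (w x) * H q ?u x * cnj (?u x)
      = (\<Sum>y\<in>nbrs x. of_real (a (x, y) * \<phi> x * (\<phi> x - \<phi> y)) * (\<sigma> (y, x) * v y * cnj (v x)))" for x
  proof -
    \<comment> \<open>Subtracting \<open>\<phi> x\<close> times the equation
      \<open>H q v x = 0\<close> cancels the potential and the diagonal terms and leaves the
      difference \<open>\<phi> x - \<phi> y\<close>.\<close>
    have "of_real (w x) * H q ?u x = of_real (w x) * H q ?u x - of_real (\<phi> x) * (of_real (w x) * H q v x)"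
      by (simp add: v)
    also have "\<dots> = (\<Sum>y\<in>nbrs x. of_real (a (x, y) * (\<phi> x - \<phi> y)) * (\<sigma> (y, x) * v y))"
      unfolding weighted_H
      by (simp add: algebra_simps sum_distrib_left flip: sum_subtractf sum.distrib)
    finally show ?thesis
      by (simp add: sum_distrib_left sum_distrib_right ac_simps)
  qed
  have "ell2_inner w (H q ?u) ?u = (\<Sum>x\<in>S. of_real (w x) * H q ?u x * cnj (?u x))"
    using S by (rule ell2_inner_finite_support) (auto simp: S_def closed_nbhd_def)
  moreover have Re_mult: "Re (of_real c * z) = c * Re z" for c z
    by simp
  have "Re (of_real (a (x, y) * \<phi> x * (\<phi> x - \<phi> y)) * (\<sigma> (y, x) * v y * cnj (v x))) = F x y"
    for x y
    unfolding F_def K_def Re_mult by (simp only: ac_simps)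
  ultimately have inner: "Re (ell2_inner w (H q ?u) ?u) = (\<Sum>x\<in>S. \<Sum>y\<in>nbrs x. F x y)"
    unfolding form by (simp only: Re_sum)
  have swap_F: "(\<Sum>x\<in>S. \<Sum>y\<in>nbrs x. F x y) = (\<Sum>x\<in>S. \<Sum>y\<in>nbrs x. F y x)"
    using S by (rule sum_nbrs_swap) (use edge_S in \<open>auto simp: F_def\<close>)
  have swap_G: "(\<Sum>x\<in>S. \<Sum>y\<in>nbrs x. G x y) = (\<Sum>x\<in>S. \<Sum>y\<in>nbrs x. G y x)"
    using S by (rule sum_nbrs_swap) (use edge_S in \<open>fastforce simp: G_def\<close>)
  \<comment> \<open>Adding the two directions turns the first-order difference of \<phi> into its
    square; the inequality of arithmetic and geometric means then separates \<open>v x\<close> from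
    \<open>v y\<close>.\<close>
  have FG: "F x y + F y x \<le> (G x y + G y x) / 2" if xy: "y \<in> nbrs x" for x y
  proof -
    have "Re (\<sigma> (x, y) * v x * cnj (v y)) = Re (\<sigma> (y, x) * v y * cnj (v x))"
      unfolding phase_swap[OF xy] by (simp add: algebra_simps)
    then have "K y x = K x y"
      by (simp only: K_def a_sym[OF xy])
    then have "F x y + F y x = K x y * (\<phi> x - \<phi> y)\<^sup>2"
      by (simp add: F_def power2_eq_square algebra_simps)
    also have "\<dots> \<le> (a (x, y) * (((cmod (v x))\<^sup>2 + (cmod (v y))\<^sup>2) / 2)) * (\<phi> x - \<phi> y)\<^sup>2"
    proof (rule mult_right_mono)
      have "Re (\<sigma> (y, x) * v y * cnj (v x)) \<le> cmod (v x) * cmod (v y)"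
        using complex_Re_le_cmod[of "\<sigma> (y, x) * v y * cnj (v x)"] norm_phase[OF xy]
        by (simp add: norm_mult phase_swap[OF xy] mult.commute)
      also have "\<dots> \<le> ((cmod (v x))\<^sup>2 + (cmod (v y))\<^sup>2) / 2"
        using sum_squares_bound[of "cmod (v x)" "cmod (v y)"] by simp
      finally show "K x y \<le> a (x, y) * (((cmod (v x))\<^sup>2 + (cmod (v y))\<^sup>2) / 2)"
        unfolding K_def using a_pos[OF xy] by (intro mult_left_mono) auto
    qed simp
    also have "\<dots> = (G x y + G y x) / 2"
      by (simp add: G_def a_sym[OF xy] power2_commute[of "\<phi> y"] field_simps)
    finally show ?thesis .
  qed
  \<comment> \<open>Counting each edge in both directions doubles the form, which is the source of
    the factor 1/2 in the bound.\<close>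
  have "2 * Re (ell2_inner w (H q ?u) ?u) = (\<Sum>x\<in>S. \<Sum>y\<in>nbrs x. F x y + F y x)"
    unfolding inner by (simp add: sum.distrib swap_F)
  also have "\<dots> \<le> (\<Sum>x\<in>S. \<Sum>y\<in>nbrs x. (G x y + G y x) / 2)"
    by (intro sum_mono FG)
  also have "\<dots> = (\<Sum>x\<in>S. \<Sum>y\<in>nbrs x. G x y)"
    by (simp add: sum.distrib swap_G add_divide_distrib flip: sum_divide_distrib)
  also have "\<dots> \<le> (\<Sum>x\<in>S. L * N * (w x * (cmod (v x))\<^sup>2))"
  proof (rule sum_mono)
    fix x
    have "(\<Sum>y\<in>nbrs x. G x y) \<le> (\<Sum>y\<in>nbrs x. L * w x * (cmod (v x))\<^sup>2)"
      unfolding G_def by (intro sum_mono mult_right_mono L) auto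
    also have "\<dots> = real (degree E x) * (L * w x * (cmod (v x))\<^sup>2)"
      by (simp add: card_nbrs)
    also have "\<dots> \<le> N * (L * w x * (cmod (v x))\<^sup>2)"
      using N L(2) by (intro mult_right_mono) auto
    finally show "(\<Sum>y\<in>nbrs x. G x y) \<le> L * N * (w x * (cmod (v x))\<^sup>2)"
      by (simp add: ac_simps)
  qed
  also have "\<dots> \<le> L * N * (ell2_norm w v)\<^sup>2"
    \<comment> \<open>The degree bound at the arbitrary vertex \<open>undefined\<close> shows that
      \<open>N\<close> is nonnegative.\<close>
    unfolding sum_distrib_left[symmetric]
    using sum_le_ell2_norm_power2[OF v(1) S] N[of undefined] L(2)
    by (intro mult_left_mono) (auto intro: order_trans[OF of_nat_0_le_iff])
  finally show ?thesis
    by simp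
qed

section \<open>Finiteness of balls\<close>

text \<open>On an edge, \<open>a (x, y)\<close> times the square of this length is
  \<open>min (w x) (w y)\<close>, so functions that are Lipschitz for the metric have differences
  controlled by \<open>w\<close>.\<close>

definition edge_length :: "'v \<Rightarrow> 'v \<Rightarrow> real" where
  "edge_length x y = sqrt (min (w x) (w y) / a (x, y))"

lemma edge_length_pos: "y \<in> nbrs x \<Longrightarrow> edge_length x y > 0"
  using w_pos a_pos by (simp add: edge_length_def)

lemma path_weight_Cons: "path_weight w a (x # y # zs) = edge_length x y + path_weight w a (y # zs)"
  by (simp add: path_weight_def edge_length_def sum.lessThan_Suc_shift del: sum.lessThan_Suc)

lemma graph_paths_Cons:
  "x # y # zs \<in> graph_paths E x' z \<longleftrightarrow> x' = x \<and> y \<in> nbrs x \<and> y # zs \<in> graph_paths E y z"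
proof -
  \<comment> \<open>The condition at index 0 is the first edge; the conditions at successors
    describe the rest of the path.\<close>
  have split: "(\<forall>j. P j) \<longleftrightarrow> P 0 \<and> (\<forall>j. P (Suc j))" for P :: "nat \<Rightarrow> bool"
    by (metis nat.exhaust)
  have "(\<forall>j. Suc j < length (x # y # zs) \<longrightarrow> {(x # y # zs) ! j, (x # y # zs) ! Suc j} \<in> E)
    \<longleftrightarrow> {x, y} \<in> E \<and> (\<forall>j. Suc j < length (y # zs) \<longrightarrow> {(y # zs) ! j, (y # zs) ! Suc j} \<in> E)"
    by (subst split) simp
  then show ?thesis
    by (auto simp: graph_paths_def nbrs_def)
qed

lemma path_weight_nonneg: "xs \<in> graph_paths E x y \<Longrightarrow> path_weight w a xs \<ge> 0"
  unfolding path_weight_def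
proof (rule sum_nonneg)
  fix j
  assume "xs \<in> graph_paths E x y" "j \<in> {..<length xs - 1}"
  then have "xs ! Suc j \<in> nbrs (xs ! j)"
    by (auto simp: graph_paths_def nbrs_def)
  then show "0 \<le> sqrt (min (w (xs ! j)) (w (xs ! Suc j)) / a (xs ! j, xs ! Suc j))"
    using edge_length_pos less_imp_le unfolding edge_length_def by blast
qed

lemma bdd_below_path_weight: "bdd_below (path_weight w a ` graph_paths E x y)"
  by (rule bdd_belowI2[where m = 0]) (rule path_weight_nonneg)

lemma graph_paths_nonempty: "graph_paths E x y \<noteq> {}"
  using connected by (simp add: connected_graph_def)

lemma wdist_le: "xs \<in> graph_paths E x y \<Longrightarrow> wdist E w a x y \<le> path_weight w a xs"
  unfolding wdist_def using bdd_below_path_weight by (rule cINF_lower)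

lemma wdist_nonneg: "wdist E w a x y \<ge> 0"
  unfolding wdist_def using graph_paths_nonempty path_weight_nonneg by (rule cINF_greatest)

lemma wdist_edge:
  assumes "y \<in> nbrs x"
  shows "wdist E w a x y \<le> edge_length x y"
proof -
  have "[x, y] \<in> graph_paths E x y"
    using assms by (simp add: graph_paths_Cons) (simp add: graph_paths_def)
  from wdist_le[OF this] show ?thesis
    by (simp add: path_weight_Cons) (simp add: path_weight_def)
qed

text \<open>A shortest path need not exist, but the strict bound gives a path of weight below
  \<open>r\<close>. It has a first edge since its ends differ, and the remainder bounds the distance
  from \<open>y\<close>.\<close>

lemma wdist_less_first_step:
  assumes "wdist E w a x z < r" "x \<noteq> z"
  obtains y where "y \<in> nbrs x" "wdist E w a y z < r - edge_length x y"
proof -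
  obtain xs where xs: "xs \<in> graph_paths E x z" "path_weight w a xs < r"
    using assms(1) unfolding wdist_def
    by (subst (asm) cINF_less_iff[OF graph_paths_nonempty bdd_below_path_weight]) auto
  obtain y zs where "xs = x # y # zs"
    using xs(1) assms(2)
    by (cases xs; cases "tl xs") (auto simp: graph_paths_def)
  then have "y \<in> nbrs x" "y # zs \<in> graph_paths E y z"
    "edge_length x y + path_weight w a (y # zs) < r"
    using xs by (simp_all add: graph_paths_Cons path_weight_Cons)
  then show ?thesis
    using wdist_le[of "y # zs" y z] by (intro that[of y]) auto
qed

text \<open>Leaving \<open>x\<close> costs at least its shortest incident edge, and there are only
  finitely many of these.\<close>

lemma wdist_isolated:
  obtains \<delta> where "\<delta> > 0" "\<And>z. wdist E w a x z < \<delta> \<Longrightarrow> z = x"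
proof
  \<comment> \<open>Inserting 1 keeps the set nonempty even if \<open>x\<close> has no
    neighbours.\<close>
  let ?\<delta> = "Min (insert 1 (edge_length x ` nbrs x))"
  show "?\<delta> > 0"
    by (auto simp: edge_length_pos)
  show "z = x" if z: "wdist E w a x z < ?\<delta>" for z
  proof (rule ccontr)
    assume "z \<noteq> x"
    then obtain y where y: "y \<in> nbrs x" "wdist E w a y z < ?\<delta> - edge_length x y"
      using wdist_less_first_step[OF z] by blast
    then have "?\<delta> \<le> edge_length x y"
      by (intro Min_le) auto
    then show False
      using y(2) wdist_nonneg[of y z] by linarith
  qed
qed

text \<open>If the ball of radius \<open>r\<close> about \<open>x\<close> is infinite, so is the ball of radius
  \<open>r - edge_length x y\<close> about some neighbour \<open>y\<close> of \<open>x\<close>. Iterating yields a Cauchy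
  sequence whose consecutive vertices differ, but every vertex is isolated.\<close>

lemma finite_ball:
  assumes complete: "complete_metric (wdist E w a)"
  shows "finite {z. wdist E w a x z < r}"
proof (rule ccontr)
  assume inf: "infinite {z. wdist E w a x z < r}"
  interpret M: Metric_space UNIV "wdist E w a"
    using complete by (simp add: complete_metric_def)
  \<comment> \<open>A state is a centre together with a radius; the invariant says that its ball is
    infinite.\<close>
  define P where "P p \<longleftrightarrow> infinite {z. wdist E w a (fst p) z < snd p}" for p :: "'v \<times> real"
  have step: "\<exists>p'. P p' \<and> fst p' \<in> nbrs (fst p) \<and> snd p' = snd p - edge_length (fst p) (fst p')"
    if "P p" for p
  proof -
    obtain x r where p: "p = (x, r)"
      by fastforce
    \<comment> \<open>Apart from \<open>x\<close>, the ball is covered by finitely many smaller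
      balls about neighbours, one of which must be infinite.\<close>
    have "{z. wdist E w a x z < r}
        \<subseteq> insert x (\<Union>y\<in>nbrs x. {z. wdist E w a y z < r - edge_length x y})"
      using wdist_less_first_step by fastforce
    then have "infinite (\<Union>y\<in>nbrs x. {z. wdist E w a y z < r - edge_length x y})"
      using that finite_subset unfolding P_def p by fastforce
    then obtain y where "y \<in> nbrs x" "infinite {z. wdist E w a y z < r - edge_length x y}"
      by auto
    then show ?thesis
      by (intro exI[of _ "(y, r - edge_length x y)"]) (simp add: P_def p)
  qed
  have "P (x, r)"
    using inf by (simp add: P_def)
  then obtain p where p: "\<And>n. P (p n)" "\<And>n. fst (p (Suc n)) \<in> nbrs (fst (p n))"
    "\<And>n. snd (p (Suc n)) = snd (p n) - edge_length (fst (p n)) (fst (p (Suc n)))"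
    using dependent_nat_choice[of "\<lambda>_. P" "\<lambda>_ p p'. fst p' \<in> nbrs (fst p)
      \<and> snd p' = snd p - edge_length (fst p) (fst p')"] step by metis
  define X where "X n = fst (p n)" for n
  define R where "R n = snd (p n)" for n
  have X: "X (Suc n) \<in> nbrs (X n)" and R: "R (Suc n) = R n - edge_length (X n) (X (Suc n))" for n
    using p by (simp_all add: X_def R_def)
  \<comment> \<open>An infinite ball is nonempty and distances are nonnegative. The decreasing radii
    are thus bounded below and converge.\<close>
  have "R n \<ge> 0" for n
  proof -
    have "{z. wdist E w a (X n) z < R n} \<noteq> {}"
      using p(1)[of n] unfolding P_def X_def R_def by (metis finite.emptyI)
    then obtain z where "wdist E w a (X n) z < R n"
      by blast
    then show ?thesis
      using wdist_nonneg[of "X n" z] by linarith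
  qed
  moreover have "decseq R"
    using edge_length_pos[OF X] less_imp_le by (intro decseq_SucI) (auto simp: R)
  ultimately obtain L where "R \<longlonglongrightarrow> L"
    using decseq_convergent[of R 0] by blast
  then have Cauchy: "Cauchy R"
    by (rule LIMSEQ_imp_Cauchy)
  \<comment> \<open>Each step is no longer than the radius it uses up; telescoping transfers the
    Cauchy property from \<open>R\<close> to \<open>X\<close>.\<close>
  have dist_R: "wdist E w a (X n) (X (n + k)) \<le> R n - R (n + k)" for n k
  proof (induction k)
    case (Suc k)
    have "wdist E w a (X n) (X (n + Suc k))
        \<le> wdist E w a (X n) (X (n + k)) + wdist E w a (X (n + k)) (X (n + Suc k))"
      by (rule M.triangle) auto
    then show ?case
      using Suc.IH wdist_edge[OF X, of "n + k"] R[of "n + k"] by simp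
  qed (simp add: M.mdist_zero)
  have dist_R': "wdist E w a (X m) (X n) \<le> \<bar>R m - R n\<bar>" for m n
    using dist_R[of m "n - m"] dist_R[of n "m - n"] M.commute[of "X m" "X n"]
    by (cases "m \<le> n") auto
  have "M.MCauchy X"
    unfolding M.MCauchy_def
  proof (intro conjI allI impI)
    fix \<epsilon> :: real
    assume "\<epsilon> > 0"
    then obtain n0 where "\<And>m n. m \<ge> n0 \<Longrightarrow> n \<ge> n0 \<Longrightarrow> \<bar>R m - R n\<bar> < \<epsilon>"
      using CauchyD[OF Cauchy] by fastforce
    then show "\<exists>N. \<forall>n n'. N \<le> n \<longrightarrow> N \<le> n' \<longrightarrow> wdist E w a (X n) (X n') < \<epsilon>"
      using dist_R' le_less_trans by blast
  qed simp
  then obtain l where "limitin M.mtopology X l sequentially"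
    using complete unfolding complete_metric_def M.mcomplete_def by blast
  moreover obtain \<delta> where \<delta>: "\<delta> > 0" "\<And>z. wdist E w a l z < \<delta> \<Longrightarrow> z = l"
    using wdist_isolated by blast
  ultimately obtain n where "\<And>m. m \<ge> n \<Longrightarrow> X m = l"
    unfolding M.limit_metric_sequentially using M.commute by metis
  \<comment> \<open>By isolation the sequence is eventually equal to \<open>l\<close>, which would
    make \<open>l\<close> its own neighbour.\<close>
  then show False
    using X[of n] not_in_nbrs_self[of l] by simp
qed

section \<open>Triviality of the kernel\<close>

lemma kernel_trivial:
  assumes complete: "complete_metric (wdist E w a)"
    and bounded: "bounded_degree E"
    and coercive: "\<And>u. u \<in> finitely_supported \<Longrightarrow> (ell2_norm w u)\<^sup>2 \<le> Re (ell2_inner w (H q u) u)"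
    and v: "v \<in> ell2 w" "\<And>x. H q v x = 0"
  shows "v x = 0"
proof -
  interpret M: Metric_space UNIV "wdist E w a"
    using complete by (simp add: complete_metric_def)
  obtain N where N: "\<And>x. real (degree E x) \<le> N"
    using bounded by (auto simp: bounded_degree_def)
  have bound: "w x * (cmod (v x))\<^sup>2 \<le> (1 / real (Suc n))\<^sup>2 * N / 2 * (ell2_norm w v)\<^sup>2" for n
  proof -
    define c where "c = 1 / real (Suc n)"
    have c: "c > 0"
      by (simp add: c_def)
    \<comment> \<open>This cutoff is 1 at \<open>x\<close>, vanishes at distance
      \<open>1 / c\<close> and beyond, and is Lipschitz with constant \<open>c\<close>.\<close>
    define \<phi> where "\<phi> y = max 0 (1 - c * wdist E w a x y)" for y
    have "{y. \<phi> y \<noteq> 0} \<subseteq> {y. wdist E w a x y < 1 / c}"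
      using c by (auto simp: \<phi>_def max_def field_simps split: if_splits)
    then have fin: "finite {y. \<phi> y \<noteq> 0}"
      using finite_ball[OF complete] finite_subset by blast
    have edge: "a (y, z) * (\<phi> y - \<phi> z)\<^sup>2 \<le> c\<^sup>2 * w y" if yz: "z \<in> nbrs y" for y z
    proof -
      have "\<bar>wdist E w a x y - wdist E w a x z\<bar> \<le> wdist E w a y z"
        using M.triangle[of x y z] M.triangle[of x z y] M.commute[of y z] by simp
      also have "\<dots> \<le> edge_length y z"
        using yz by (rule wdist_edge)
      finally have "c * \<bar>wdist E w a x y - wdist E w a x z\<bar> \<le> c * edge_length y z"
        using c by (intro mult_left_mono) auto
      moreover have "\<bar>\<phi> y - \<phi> z\<bar> \<le> \<bar>c * wdist E w a x y - c * wdist E w a x z\<bar>"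
        by (auto simp: \<phi>_def max_def)
      ultimately have "\<bar>\<phi> y - \<phi> z\<bar> \<le> c * edge_length y z"
        unfolding right_diff_distrib[symmetric] abs_mult abs_of_pos[OF c]
        by (rule order_trans[rotated])
      then have "(\<phi> y - \<phi> z)\<^sup>2 \<le> (c * edge_length y z)\<^sup>2"
        by (metis abs_ge_zero power2_abs power_mono)
      also have "\<dots> = c\<^sup>2 * (min (w y) (w z) / a (y, z))"
        using a_pos[OF yz] by (simp add: power_mult_distrib edge_length_def)
      \<comment> \<open>The factor \<open>a (y, z)\<close> cancels the denominator in the squared
        edge length, leaving only a vertex weight.\<close>
      finally have "a (y, z) * (\<phi> y - \<phi> z)\<^sup>2 \<le> a (y, z) * (c\<^sup>2 * (min (w y) (w z) / a (y, z)))"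
        using a_pos[OF yz] by (intro mult_left_mono) auto
      also have "\<dots> = c\<^sup>2 * min (w y) (w z)"
        using a_pos[OF yz] by simp
      also have "\<dots> \<le> c\<^sup>2 * w y"
        by (intro mult_left_mono) auto
      finally show ?thesis .
    qed
    let ?u = "\<lambda>y. \<phi> y * v y"
    have u: "?u \<in> finitely_supported"
      using fin by (auto simp: finitely_supported_def elim: rev_finite_subset)
    have "\<phi> x = 1"
      by (simp add: \<phi>_def M.mdist_zero)
    then have "w x * (cmod (v x))\<^sup>2 \<le> (ell2_norm w ?u)\<^sup>2"
      using sum_le_ell2_norm_power2[of ?u "{x}"] u finitely_supported_subset_ell2 by auto
    also have "\<dots> \<le> Re (ell2_inner w (H q ?u) ?u)"
      using u by (rule coercive)
    also have "\<dots> \<le> c\<^sup>2 * N / 2 * (ell2_norm w v)\<^sup>2"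
      by (rule cutoff_estimate[OF fin edge _ N v]) (assumption | rule zero_le_power2)+
    finally show ?thesis
      by (simp add: c_def)
  qed
  \<comment> \<open>The left side of \<open>bound\<close> does not depend on \<open>n\<close>, so
    widening the cutoff forces it to be at most 0.\<close>
  have "(\<lambda>n. (1 / real (Suc n))\<^sup>2 * N / 2 * (ell2_norm w v)\<^sup>2) \<longlonglongrightarrow> 0\<^sup>2 * N / 2 * (ell2_norm w v)\<^sup>2"
    using LIMSEQ_inverse_real_of_nat by (intro tendsto_intros) (simp_all add: inverse_eq_divide)
  then have "w x * (cmod (v x))\<^sup>2 \<le> 0\<^sup>2 * N / 2 * (ell2_norm w v)\<^sup>2"
    by (rule LIMSEQ_le_const) (use bound in blast)
  then show ?thesis
    using w_pos[of x] by (simp add: mult_le_0_iff)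
qed

section \<open>Essential self-adjointness\<close>

text \<open>This is the maximal realization of \<open>H\<close>; it turns out to be the adjoint of
  the minimal one, \<open>H_min\<close>.\<close>

definition H_max :: "('v \<Rightarrow> real) \<Rightarrow> 'v op_graph" where
  "H_max q = {(v, H q v) | v. v \<in> ell2 w \<and> H q v \<in> ell2 w}"

abbreviation H_min :: "('v \<Rightarrow> real) \<Rightarrow> 'v op_graph" where
  "H_min q \<equiv> restrict_op (H q) finitely_supported"

lemma H_min_subset_H_max: "H_min q \<subseteq> H_max q"
  using finitely_supported_subset_ell2 H_finitely_supported
  by (auto simp: restrict_op_def H_max_def)

lemma densely_defined_H_min: "densely_defined w (H_min q)"
proof -
  have "Domain (H_min q) = finitely_supported"
    by (auto simp: restrict_op_def)
  then show ?thesis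
    unfolding densely_defined_def using finitely_supported_dense by metis
qed

lemma densely_defined_H_max: "densely_defined w (H_max q)"
  using densely_defined_H_min[of q] Domain_mono[OF H_min_subset_H_max[of q]]
  unfolding densely_defined_def by blast

lemma linear_op_H_min: "linear_op w (H_min q)"
proof -
  have "H q (\<lambda>x. u x + v x) = (\<lambda>x. H q u x + H q v x)" "H q (\<lambda>x. c * u x) = (\<lambda>x. c * H q u x)"
    for u v c
    by (simp_all add: fun_eq_iff H_add H_scale)
  moreover from this(2)[of 0] have "H q (\<lambda>x. 0) = (\<lambda>x. 0)"
    by simp
  moreover have "(\<lambda>x. 0) \<in> finitely_supported"
    by (simp add: finitely_supported_def)
  moreover have "H_min q \<subseteq> ell2 w \<times> ell2 w"
    using H_min_subset_H_max by (auto simp: H_max_def)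
  ultimately show ?thesis
    by (auto simp: linear_op_def restrict_op_def single_valued_def
        finitely_supported_add finitely_supported_scale)
qed

lemma symmetric_op_H_min: "symmetric_op w (H_min q)"
proof -
  have "ell2_inner w f v = ell2_inner w u g" if "(u, f) \<in> H_min q" "(v, g) \<in> H_min q" for u f v g
    using that Green by (auto simp: restrict_op_def)
  then show ?thesis
    using linear_op_H_min densely_defined_H_min by (fastforce simp: symmetric_op_def)
qed

text \<open>Green's formula moves \<open>H\<close> onto \<open>v\<close>, and testing with point
  masses identifies \<open>g\<close> at each vertex. With \<open>g = 0\<close>, a function
  orthogonal to the range of \<open>H_min\<close> solves \<open>H q v = 0\<close>.\<close>

lemma orthogonal_to_range:
  assumes "\<And>u. u \<in> finitely_supported \<Longrightarrow> ell2_inner w (H q u) v = ell2_inner w u g"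
  shows "g = H q v"
proof
  fix x
  define u :: "'v \<Rightarrow> complex" where "u = (\<lambda>y. if y = x then 1 else 0)"
  have u: "u \<in> finitely_supported"
    by (simp add: u_def finitely_supported_def)
  have "ell2_inner w u h = of_real (w x) * cnj (h x)" for h
    using ell2_inner_finite_support[of "{x}" u h] by (simp add: u_def)
  then have "of_real (w x) * cnj (g x) = of_real (w x) * cnj (H q v x)"
    using assms[OF u] Green[OF u] by metis
  then show "g x = H q v x"
    using w_pos[of x] by simp
qed

lemma adjoint_H_min: "adjoint_op w (H_min q) = H_max q"
  using orthogonal_to_range Green
  by (fastforce simp: adjoint_op_def restrict_op_def H_max_def)

text \<open>Norm convergence implies pointwise convergence, and \<open>H\<close> at a vertex
  involves only finitely many values, so it commutes with pointwise limits.\<close>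

lemma closure_H_min_subset: "closure_op w (H_min q) \<subseteq> H_max q"
proof safe
  fix u f
  assume "(u, f) \<in> closure_op w (H_min q)"
  then obtain us fs where uf: "u \<in> ell2 w" "f \<in> ell2 w" "\<And>n. (us n, fs n) \<in> H_min q"
    and lim: "(\<lambda>n::nat. ell2_norm w (\<lambda>x. us n x - u x)) \<longlonglongrightarrow> 0"
      "(\<lambda>n. ell2_norm w (\<lambda>x. fs n x - f x)) \<longlonglongrightarrow> 0"
    using closure_opE by blast
  have us: "us n \<in> ell2 w" and fs: "fs n \<in> ell2 w" "fs n = H q (us n)" for n
    using uf(3)[of n] H_min_subset_H_max[of q] by (auto simp: H_max_def)
  have "H q u x = f x" for x
  proof (rule LIMSEQ_unique)
    show "(\<lambda>n. H q (us n) x) \<longlonglongrightarrow> H q u x"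
      using ell2_pointwise_tendsto[OF us uf(1) lim(1)] by (rule H_tendsto)
    show "(\<lambda>n. H q (us n) x) \<longlonglongrightarrow> f x"
      using ell2_pointwise_tendsto[OF fs(1) uf(2) lim(2)] unfolding fs(2) .
  qed
  then have "f = H q u"
    by auto
  then show "(u, f) \<in> H_max q"
    using uf by (simp add: H_max_def)
qed

text \<open>The range of a coercive \<open>H_min q\<close> is dense, as its orthogonal complement is the kernel
  of \<open>H_max q\<close>; hence \<open>H q v\<close> is a limit of some \<open>H q (us n)\<close>, where \<open>us\<close> is Cauchy by
  coercivity and its limit differs from \<open>v\<close> by an element of that kernel.\<close>

lemma H_max_subset_closure_coercive:
  assumes coercive: "\<And>u. u \<in> finitely_supported \<Longrightarrow> (ell2_norm w u)\<^sup>2 \<le> Re (ell2_inner w (H q u) u)"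
    and kernel: "\<And>v. v \<in> ell2 w \<Longrightarrow> (\<And>x. H q v x = 0) \<Longrightarrow> v = (\<lambda>x. 0)"
  shows "H_max q \<subseteq> closure_op w (H_min q)"
proof safe
  fix v f
  assume "(v, f) \<in> H_max q"
  then have v: "v \<in> ell2 w" and f: "f = H q v" and fw: "f \<in> ell2 w"
    by (auto simp: H_max_def)
  note fs_ell2 = subsetD[OF finitely_supported_subset_ell2]
  \<comment> \<open>Coercivity and Cauchy-Schwarz give \<open>||u||^2 \<le> ||H u|| ||u||\<close>;
    one factor \<open>||u||\<close> cancels unless it is 0.\<close>
  have bound: "ell2_norm w u \<le> ell2_norm w (H q u)" if u: "u \<in> finitely_supported" for u
  proof -
    have "(ell2_norm w u)\<^sup>2 \<le> cmod (ell2_inner w (H q u) u)"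
      using coercive[OF u] complex_Re_le_cmod order_trans by blast
    also have "\<dots> \<le> ell2_norm w (H q u) * ell2_norm w u"
      by (intro ell2_Cauchy_Schwarz fs_ell2 H_finitely_supported u)
    finally show ?thesis
      using ell2_norm_nonneg[of u] ell2_norm_nonneg[of "H q u"]
      by (cases "ell2_norm w u = 0") (auto simp: power2_eq_square)
  qed
  let ?M = "H q ` finitely_supported"
  obtain ms where ms: "\<And>n. ms n \<in> ?M" and lim: "(\<lambda>n::nat. ell2_norm w (\<lambda>x. ms n x - f x)) \<longlonglongrightarrow> 0"
  proof (rule ell2_dense_if_orthogonal_trivial[of ?M f])
    show "?M \<subseteq> ell2 w"
      using fs_ell2 H_finitely_supported by blast
    show "?M \<noteq> {}"
      using finitely_supported_scale by (auto simp: finitely_supported_def intro!: exI[of _ "\<lambda>x. 0"])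
    show "(\<lambda>x. g x + h x) \<in> ?M" if gh: "g \<in> ?M" "h \<in> ?M" for g h
    proof -
      obtain u u' where "u \<in> finitely_supported" "u' \<in> finitely_supported" "g = H q u" "h = H q u'"
        using gh by blast
      then show ?thesis
        by (intro image_eqI[of _ _ "\<lambda>x. u x + u' x"] finitely_supported_add) (auto simp: H_add)
    qed
    show "(\<lambda>x. c * g x) \<in> ?M" if g: "g \<in> ?M" for c g
    proof -
      obtain u where "u \<in> finitely_supported" "g = H q u"
        using g by blast
      then show ?thesis
        by (intro image_eqI[of _ _ "\<lambda>x. c * u x"] finitely_supported_scale) (auto simp: H_scale)
    qed
    show "g = (\<lambda>x. 0)" if g: "g \<in> ell2 w" "\<And>m. m \<in> ?M \<Longrightarrow> ell2_inner w m g = 0" for g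
    proof -
      have "(\<lambda>x. 0) = H q g"
        by (rule orthogonal_to_range) (simp add: g(2), simp add: ell2_inner_def)
      then show ?thesis
        using kernel[OF g(1)] by metis
    qed
  qed (use fw in auto)
  have "\<forall>n. \<exists>u. u \<in> finitely_supported \<and> ms n = H q u"
    using ms by blast
  then obtain us where us: "\<And>n. us n \<in> finitely_supported" and ms_us: "\<And>n. ms n = H q (us n)"
    by metis
  have ms_ell2: "ms n \<in> ell2 w" for n
    unfolding ms_us by (intro fs_ell2 H_finitely_supported us)
  have diff: "ell2_norm w (\<lambda>x. us m x - us n x)
      \<le> ell2_norm w (\<lambda>x. ms m x - f x) + ell2_norm w (\<lambda>x. ms n x - f x)" for m n
  proof -
    have "(\<lambda>x. us m x + - 1 * us n x) \<in> finitely_supported"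
      by (intro finitely_supported_add finitely_supported_scale us)
    then have "ell2_norm w (\<lambda>x. us m x - us n x) \<le> ell2_norm w (H q (\<lambda>x. us m x - us n x))"
      using bound by simp
    also have "H q (\<lambda>x. us m x - us n x) = (\<lambda>x. (ms m x - f x) + (f x - ms n x))"
      by (simp add: fun_eq_iff H_diff ms_us)
    also have "ell2_norm w \<dots> \<le> ell2_norm w (\<lambda>x. ms m x - f x) + ell2_norm w (\<lambda>x. f x - ms n x)"
      by (intro ell2_norm_triangle ell2_diff ms_ell2 fw)
    finally show ?thesis
      by (subst ell2_norm_minus_commute[of "ms n"])
  qed
  have "\<exists>N. \<forall>m\<ge>N. \<forall>n\<ge>N. ell2_norm w (\<lambda>x. us m x - us n x) < \<epsilon>" if "\<epsilon> > 0" for \<epsilon>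
  proof -
    have "\<forall>\<^sub>F n in sequentially. ell2_norm w (\<lambda>x. ms n x - f x) < \<epsilon> / 2"
      using order_tendstoD(2)[OF lim, of "\<epsilon> / 2"] that by simp
    then obtain N where N: "\<And>n. n \<ge> N \<Longrightarrow> ell2_norm w (\<lambda>x. ms n x - f x) < \<epsilon> / 2"
      by (auto simp: eventually_sequentially)
    have "ell2_norm w (\<lambda>x. us m x - us n x) < \<epsilon>" if "m \<ge> N" "n \<ge> N" for m n
      using diff[of m n] N[OF that(1)] N[OF that(2)] by linarith
    then show ?thesis
      by blast
  qed
  then obtain u where u: "u \<in> ell2 w" and lim_u: "(\<lambda>n. ell2_norm w (\<lambda>x. us n x - u x)) \<longlonglongrightarrow> 0"
    using ell2_complete[of us, OF fs_ell2[OF us]] by blast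
  have mem: "(u, f) \<in> closure_op w (H_min q)"
  proof (rule closure_opI)
    show "(us n, ms n) \<in> H_min q" for n
      using us by (auto simp: restrict_op_def ms_us)
  qed (rule u fw lim_u lim)+
  then have "H q u = f"
    using closure_H_min_subset by (fastforce simp: H_max_def)
  \<comment> \<open>Both \<open>v\<close> and \<open>u\<close> are mapped to \<open>f\<close>, so
    their difference lies in the trivial kernel.\<close>
  then have "(\<lambda>x. v x - u x) = (\<lambda>x. 0)"
    by (intro kernel ell2_diff v u) (simp add: H_diff f)
  then have "v = u"
    by (simp add: fun_eq_iff)
  then show "(v, f) \<in> closure_op w (H_min q)"
    using mem by simp
qed

text \<open>A constant added to \<open>q\<close> acts as a bounded operator, so it changes neither
  the maximal domain nor which sequences converge in graph norm; the coercive case therefore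
  suffices.\<close>

lemma H_max_subset_closure:
  assumes complete: "complete_metric (wdist E w a)"
    and bounded: "bounded_degree E"
    and semibounded: "\<And>u. u \<in> finitely_supported \<Longrightarrow>
      Re (ell2_inner w (H q u) u) \<ge> - C * (ell2_norm w u)\<^sup>2"
  shows "H_max q \<subseteq> closure_op w (H_min q)"
proof safe
  \<comment> \<open>Adding \<open>C\<close> would only make the form nonnegative; the extra 1 gives
    the lower bound by the squared norm.\<close>
  let ?q = "\<lambda>x. q x + (C + 1)"
  note fs_ell2 = subsetD[OF finitely_supported_subset_ell2]
  have coercive: "(ell2_norm w u)\<^sup>2 \<le> Re (ell2_inner w (H ?q u) u)"
    if u: "u \<in> finitely_supported" for u
  proof -
    have "H ?q u = (\<lambda>x. H q u x + of_real (C + 1) * u x)"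
      using H_shift by blast
    then have "ell2_inner w (H ?q u) u
        = ell2_inner w (H q u) u + of_real (C + 1) * of_real ((ell2_norm w u)\<^sup>2)"
      using fs_ell2[OF u] fs_ell2[OF H_finitely_supported[OF u]]
      by (simp only: ell2_inner_add_left ell2_scale ell2_inner_scale_left ell2_inner_self)
    then have "Re (ell2_inner w (H ?q u) u)
        = Re (ell2_inner w (H q u) u) + (C + 1) * (ell2_norm w u)\<^sup>2"
      by (simp flip: of_real_mult del: of_real_add of_real_power)
    then show ?thesis
      using semibounded[OF u] by (simp add: algebra_simps)
  qed
  have kernel: "v = (\<lambda>x. 0)" if "v \<in> ell2 w" "\<And>x. H ?q v x = 0" for v
    using kernel_trivial[OF complete bounded coercive that] by blast
  fix v f
  assume "(v, f) \<in> H_max q"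
  then have v: "v \<in> ell2 w" and f: "f = H q v" and fw: "f \<in> ell2 w"
    by (auto simp: H_max_def)
  have "H ?q v = (\<lambda>x. f x + of_real (C + 1) * v x)"
    using H_shift f by blast
  then have "(v, \<lambda>x. f x + of_real (C + 1) * v x) \<in> H_max ?q"
    using ell2_add[OF fw ell2_scale[OF v]] v by (auto simp: H_max_def)
  with H_max_subset_closure_coercive[OF coercive kernel]
  obtain us gs where us_gs: "\<And>n. (us n, gs n) \<in> H_min ?q"
    and lim_u: "(\<lambda>n::nat. ell2_norm w (\<lambda>x. us n x - v x)) \<longlonglongrightarrow> 0"
    and lim_g: "(\<lambda>n. ell2_norm w (\<lambda>x. gs n x - (f x + of_real (C + 1) * v x))) \<longlonglongrightarrow> 0"
    unfolding closure_op_def by blast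
  have us: "us n \<in> finitely_supported" and gs: "gs n = H ?q (us n)" for n
    using us_gs[of n] by (auto simp: restrict_op_def)
  have "(\<lambda>n. ell2_norm w (\<lambda>x. H q (us n) x - f x)) \<longlonglongrightarrow> 0"
  proof (rule Lim_null_comparison)
    show "(\<lambda>n. ell2_norm w (\<lambda>x. gs n x - (f x + of_real (C + 1) * v x))
        + cmod (- of_real (C + 1)) * ell2_norm w (\<lambda>x. us n x - v x)) \<longlonglongrightarrow> 0"
      using tendsto_add[OF lim_g tendsto_mult_right_zero[OF lim_u]] by simp
    have "ell2_norm w (\<lambda>x. H q (us n) x - f x)
        \<le> ell2_norm w (\<lambda>x. gs n x - (f x + of_real (C + 1) * v x))
          + cmod (- of_real (C + 1)) * ell2_norm w (\<lambda>x. us n x - v x)" for n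
    proof -
      \<comment> \<open>Undoing the shift subtracts \<open>C + 1\<close> times the error of
        \<open>us n\<close>, which tends to 0 as well.\<close>
      have "(\<lambda>x. H q (us n) x - f x) = (\<lambda>x. (gs n x - (f x + of_real (C + 1) * v x))
          + - of_real (C + 1) * (us n x - v x))"
        unfolding gs H_shift by (simp add: fun_eq_iff algebra_simps)
      then show ?thesis
        unfolding ell2_norm_scale[symmetric] gs
        by (simp only:) (intro ell2_norm_triangle ell2_diff ell2_add ell2_scale fw v fs_ell2
          H_finitely_supported us)
    qed
    then show "\<forall>\<^sub>F n in sequentially. norm (ell2_norm w (\<lambda>x. H q (us n) x - f x))
        \<le> ell2_norm w (\<lambda>x. gs n x - (f x + of_real (C + 1) * v x))
          + cmod (- of_real (C + 1)) * ell2_norm w (\<lambda>x. us n x - v x)"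
      by simp
  qed
  with v fw _ lim_u show "(v, f) \<in> closure_op w (H_min q)"
  proof (rule closure_opI)
    show "(us n, H q (us n)) \<in> H_min q" for n
      using us by (auto simp: restrict_op_def)
  qed
qed

text \<open>Adjoints reverse inclusions, so the adjoint lies in that of \<open>H_min\<close>, which
  is \<open>H_max\<close>. Conversely, symmetry extends by continuity: only \<open>u\<close> is
  approximated, since Green's formula allows an arbitrary \<open>v\<close>.\<close>

lemma adjoint_H_max:
  assumes closure: "H_max q \<subseteq> closure_op w (H_min q)"
  shows "adjoint_op w (H_max q) = H_max q"
proof
  have "adjoint_op w (H_max q) \<subseteq> adjoint_op w (H_min q)"
    using H_min_subset_H_max[of q] unfolding adjoint_op_def by blast
  then show "adjoint_op w (H_max q) \<subseteq> H_max q"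
    by (simp add: adjoint_H_min)
  have "ell2_inner w f v = ell2_inner w u g" if vg: "(v, g) \<in> H_max q" and uf: "(u, f) \<in> H_max q"
    for u f v g
  proof -
    have v: "v \<in> ell2 w" "g \<in> ell2 w" "g = H q v"
      using vg by (auto simp: H_max_def)
    obtain us fs where u: "u \<in> ell2 w" "f \<in> ell2 w" and min: "\<And>n. (us n, fs n) \<in> H_min q"
      and lim: "(\<lambda>n::nat. ell2_norm w (\<lambda>x. us n x - u x)) \<longlonglongrightarrow> 0"
        "(\<lambda>n. ell2_norm w (\<lambda>x. fs n x - f x)) \<longlonglongrightarrow> 0"
      using uf closure closure_opE by blast
    have us: "us n \<in> ell2 w" "fs n \<in> ell2 w" for n
      using min[of n] H_min_subset_H_max[of q] by (auto simp: H_max_def)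
    have "ell2_inner w (fs n) v = ell2_inner w (us n) g" for n
      using min[of n] by (auto simp: restrict_op_def Green v(3))
    with ell2_inner_tendsto_left[OF us(2) u(2) v(1) lim(2)]
    have "(\<lambda>n. ell2_inner w (us n) g) \<longlonglongrightarrow> ell2_inner w f v"
      by simp
    then show ?thesis
      using ell2_inner_tendsto_left[OF us(1) u(1) v(2) lim(1)] by (rule LIMSEQ_unique)
  qed
  then show "H_max q \<subseteq> adjoint_op w (H_max q)"
    unfolding adjoint_op_def by (auto simp: H_max_def)
qed

lemma linear_op_H_max: "linear_op w (H_max q)"
proof -
  have "H q (\<lambda>x. u x + v x) = (\<lambda>x. H q u x + H q v x)" "H q (\<lambda>x. c * u x) = (\<lambda>x. c * H q u x)"
    for u v c
    by (simp_all add: fun_eq_iff H_add H_scale)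
  moreover from this(2)[of 0] have "H q (\<lambda>x. 0) = (\<lambda>x. 0)"
    by simp
  moreover have "(\<lambda>x. 0) \<in> ell2 w"
    by (simp add: ell2_def)
  ultimately show ?thesis
    by (auto simp: linear_op_def H_max_def single_valued_def ell2_add ell2_scale)
qed

end

theorem theorem1p5:
  fixes E :: "'v set set" and Es :: "('v \<times> 'v) set"
    and w :: "'v \<Rightarrow> real" and a :: "'v \<times> 'v \<Rightarrow> real"
    and \<sigma> :: "'v \<times> 'v \<Rightarrow> complex" and q :: "'v \<Rightarrow> real"
  assumes "simple_graph E"
    and "infinite (UNIV :: 'v set)"
    and "locally_finite_graph E"
    and "connected_graph E"
    and "orientation E Es"
    and "vertex_weight w"
    and "edge_weight E a"
    and "U1_phase E \<sigma>"
    and "bounded_degree E"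
    and "complete_metric (wdist E w a)"
    and "\<exists>C::real. \<forall>u\<in>finitely_supported.
           Re (ell2_inner w (magnetic_schroedinger E w a \<sigma> q u) u) \<ge> - C * (ell2_norm w u)\<^sup>2"
  shows "essentially_self_adjoint w
           (restrict_op (magnetic_schroedinger E w a \<sigma> q) finitely_supported)"
proof -
  interpret magnetic_graph w E a \<sigma>
    using assms by unfold_locales
  obtain C where "\<And>u. u \<in> finitely_supported \<Longrightarrow> Re (ell2_inner w (H q u) u) \<ge> - C * (ell2_norm w u)\<^sup>2"
    using assms(11) by blast
  then have "H_max q \<subseteq> closure_op w (H_min q)"
    by (rule H_max_subset_closure[OF assms(10,9)])
  \<comment> \<open>The closure always lies in \<open>H_max\<close>; equality makes it self-adjoint,
    as \<open>H_max\<close> is then its own adjoint.\<close>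
  then have "closure_op w (H_min q) = H_max q"
    and "adjoint_op w (H_max q) = H_max q"
    using closure_H_min_subset adjoint_H_max by blast+
  then have "self_adjoint_op w (closure_op w (H_min q))"
    using linear_op_H_max densely_defined_H_max by (simp add: self_adjoint_op_def)
  then show ?thesis
    using symmetric_op_H_min by (simp add: essentially_self_adjoint_def)
qed

end
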